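(* Let $d\ge1$ and $n\ge d+2$. Then $L_{d,n}$ is an algebraic variety in $\mathbb C^N$ of pure dimension $dn-\binom{d+1}{2}$. If moreover $d\ge 2$, then $L_{d,n}$ is irreducible.
   Context: Let $N=\binom{n}{2}$ and index coordinates of $\mathbb C^N$ by pairs $\{i,j\}$, $1\le i<j\le n$. For a complex configuration ${\bf p}=({\bf p}_1,\dots,{\bf p}_n)$ in $\mathbb C^d$, $m({\bf p})\in\mathbb C^N$ has coordinates $m_{ij}({\bf p})=\sum_{k=1}^d({\bf p}_i^k-{\bf p}_j^k)^2$ (no conjugation). $M_{d,n}$ is the image of $m$ over all complex configurations. With $s:\mathbb C^N\to\mathbb C^N$ the map squaring each coordinate, $L_{d,n}=s^{-1}(M_{d,n})$. *)

theory Defs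
  imports Complex_Main
begin

definition aff :: "'v set \<Rightarrow> ('v \<Rightarrow> complex) set" where
  "aff I = {x. \<forall>v. v \<notin> I \<longrightarrow> x v = 0}"

inductive_set poly_fun :: "'v set \<Rightarrow> (('v \<Rightarrow> complex) \<Rightarrow> complex) set" for I where
  const: "(\<lambda>x. c) \<in> poly_fun I"
| var: "i \<in> I \<Longrightarrow> (\<lambda>x. x i) \<in> poly_fun I"
| add: "f \<in> poly_fun I \<Longrightarrow> g \<in> poly_fun I \<Longrightarrow> (\<lambda>x. f x + g x) \<in> poly_fun I"
| mult: "f \<in> poly_fun I \<Longrightarrow> g \<in> poly_fun I \<Longrightarrow> (\<lambda>x. f x * g x) \<in> poly_fun I"

definition zariski_closed :: "'v set \<Rightarrow> ('v \<Rightarrow> complex) set \<Rightarrow> bool" where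
  "zariski_closed I S \<longleftrightarrow>
     (\<exists>F \<subseteq> poly_fun I. S = {x \<in> aff I. \<forall>f\<in>F. f x = 0})"

definition zariski_irreducible :: "'v set \<Rightarrow> ('v \<Rightarrow> complex) set \<Rightarrow> bool" where
  "zariski_irreducible I S \<longleftrightarrow> zariski_closed I S \<and> S \<noteq> {} \<and>
     (\<forall>A B. zariski_closed I A \<longrightarrow> zariski_closed I B \<longrightarrow> S = A \<union> B \<longrightarrow> S = A \<or> S = B)"

definition has_irred_chain :: "'v set \<Rightarrow> ('v \<Rightarrow> complex) set \<Rightarrow> nat \<Rightarrow> bool" where
  "has_irred_chain I V k \<longleftrightarrow>
     (\<exists>Z :: nat \<Rightarrow> ('v \<Rightarrow> complex) set.
        (\<forall>i\<le>k. zariski_irreducible I (Z i) \<and> Z i \<subseteq> V) \<and>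
        (\<forall>i<k. Z i \<subset> Z (Suc i)))"

definition alg_dim_eq :: "'v set \<Rightarrow> ('v \<Rightarrow> complex) set \<Rightarrow> nat \<Rightarrow> bool" where
  "alg_dim_eq I V k \<longleftrightarrow> has_irred_chain I V k \<and> \<not> has_irred_chain I V (Suc k)"

definition irred_component :: "'v set \<Rightarrow> ('v \<Rightarrow> complex) set \<Rightarrow> ('v \<Rightarrow> complex) set \<Rightarrow> bool" where
  "irred_component I S V \<longleftrightarrow> zariski_irreducible I V \<and> V \<subseteq> S \<and>
     (\<forall>W. zariski_irreducible I W \<longrightarrow> V \<subseteq> W \<longrightarrow> W \<subseteq> S \<longrightarrow> W = V)"

definition pure_dim :: "'v set \<Rightarrow> ('v \<Rightarrow> complex) set \<Rightarrow> nat \<Rightarrow> bool" where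
  "pure_dim I S k \<longleftrightarrow> zariski_closed I S \<and>
     (\<forall>V. irred_component I S V \<longrightarrow> alg_dim_eq I V k)"

text \<open>Index set of pairs {i,j}, 1 <= i < j <= n, represented as (i,j) with i < j;
  N = n choose 2 coordinates.\<close>
definition pair_idx :: "nat \<Rightarrow> (nat \<times> nat) set" where
  "pair_idx n = {(i, j). 1 \<le> i \<and> i < j \<and> j \<le> n}"

text \<open>A configuration p: point i (1<=i<=n) has coordinates p i k (1<=k<=d).
  m_ij(p) = sum_k (p_i^k - p_j^k)^2 (no conjugation).\<close>
definition meas :: "nat \<Rightarrow> nat \<Rightarrow> (nat \<Rightarrow> nat \<Rightarrow> complex) \<Rightarrow> (nat \<times> nat \<Rightarrow> complex)" where
  "meas d n p = (\<lambda>(i, j). if (i, j) \<in> pair_idx n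
                          then (\<Sum>k=1..d. (p i k - p j k)^2) else 0)"

definition M_set :: "nat \<Rightarrow> nat \<Rightarrow> (nat \<times> nat \<Rightarrow> complex) set" where
  "M_set d n = range (meas d n)"

definition sq_map :: "('v \<Rightarrow> complex) \<Rightarrow> ('v \<Rightarrow> complex)" where
  "sq_map x = (\<lambda>v. (x v)^2)"

definition L_set :: "nat \<Rightarrow> nat \<Rightarrow> (nat \<times> nat \<Rightarrow> complex) set" where
  "L_set d n = {x \<in> aff (pair_idx n). sq_map x \<in> M_set d n}"

end

theory Submission
  imports Defs "HOL-Complex_Analysis.Complex_Analysis"
begin

text \<open>Closedness: \<open>M\<close> consists of the squared length vectors whose polarized Gram form has rank at most
  \<open>d\<close>, and the rank condition is expressed by iterated Schur complements.

  Irreducibility for \<open>d \<ge> 2\<close>: moving generic points along a fixed isotropic direction makes the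
  squared lengths linear in the time with distinct roots. The products of their square roots are
  then linearly independent over the polynomials, so a polynomial that vanishes on one branch of
  such a curve vanishes on all of them, and branches of holomorphic functions have no zero divisors.

  Dimension: the same argument applies to strata of configurations with prescribed zero coordinates.
  Releasing the coordinates of triangular configurations one by one gives a chain of the required
  length. Conversely a chain of irreducible sets of length \<open>r\<close> gives \<open>r\<close> algebraically independent
  functions, and since triangular configurations are dense up to congruence, counting monomials
  bounds \<open>r\<close> by the number of free coordinates. For \<open>d = 1\<close> the components are the linear spaces given
  by the choices of signs.\<close>

section \<open>Polynomial functions\<close>

text \<open>Dimension is measured by chains of irreducible closed subsets of \<open>L_set\<close>
  itself, so each step of the lower bound needs an irreducible cover, not only an irreducible set of
  squared lengths. Along a general line a squared length is quadratic in the time and may be a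
  perfect square, which would split the cover. An isotropic direction removes the quadratic term:
  each squared length then has one simple root, and the orders at these roots tell the products of
  square roots apart. Such a direction needs two axes. Two points confined to the first axis have a
  squared length that is already a square, so there the preimage does break up, and fixing a sign
  for each such pair restores irreducibility; this is also why \<open>d = 1\<close> is separate. The
  number \<open>d * n - ((d + 1) choose 2)\<close> counts the coordinates left once point 1 is moved
  to the origin and point \<open>i\<close> into the span of the first \<open>i - 1\<close> axes. In
  the upper bound one extra power of \<open>D\<close> beats any constant factor, so crude degree
  estimates suffice.\<close>

inductive poly_deg :: "'v set \<Rightarrow> nat \<Rightarrow> (('v \<Rightarrow> complex) \<Rightarrow> complex) \<Rightarrow> bool" for I where
  const: "poly_deg I m (\<lambda>x. c)"
| var_mult: "i \<in> I \<Longrightarrow> poly_deg I m f \<Longrightarrow> poly_deg I (Suc m) (\<lambda>x. x i * f x)"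
| add: "poly_deg I m f \<Longrightarrow> poly_deg I m g \<Longrightarrow> poly_deg I m (\<lambda>x. f x + g x)"

lemma poly_deg_mono: "poly_deg I m f \<Longrightarrow> m \<le> m' \<Longrightarrow> poly_deg I m' f"
proof (induction arbitrary: m' rule: poly_deg.induct)
  case (var_mult i m f)
  then obtain k where "m' = Suc k" "m \<le> k" by (cases m') auto
  with var_mult show ?case by (auto intro: poly_deg.var_mult)
qed (auto intro: poly_deg.intros)

lemma poly_deg_cmult: "poly_deg I m f \<Longrightarrow> poly_deg I m (\<lambda>x. c * f x)"
proof (induction rule: poly_deg.induct)
  case (var_mult i m f)
  from poly_deg.var_mult[OF var_mult(1,3)] show ?case by (simp add: mult.left_commute)
next
  case (add m f g)
  from poly_deg.add[OF add(3,4)] show ?case by (simp add: distrib_left)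
qed (rule poly_deg.const)

lemma poly_deg_mult:
  "poly_deg I m f \<Longrightarrow> poly_deg I k g \<Longrightarrow> poly_deg I (m + k) (\<lambda>x. f x * g x)"
proof (induction rule: poly_deg.induct)
  case (const m c)
  then show ?case using poly_deg_mono[OF poly_deg_cmult] by fastforce
next
  case (var_mult i m f)
  from poly_deg.var_mult[OF var_mult(1) var_mult(3)[OF var_mult(4)]]
  show ?case by (simp add: mult.assoc)
next
  case (add m f g)
  then show ?case using poly_deg.add by (fastforce simp: distrib_right)
qed

lemma poly_deg_var: "i \<in> I \<Longrightarrow> poly_deg I 1 (\<lambda>x. x i)"
  using poly_deg.var_mult[OF _ poly_deg.const[of I 0 1]] by simp

lemma poly_deg_power: "poly_deg I m f \<Longrightarrow> poly_deg I (m * j) (\<lambda>x. f x ^ j)"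
proof (induction j)
  case 0
  show ?case using poly_deg.const[of I 0 1] by simp
next
  case (Suc j)
  show ?case using poly_deg_mult[OF Suc.prems Suc.IH[OF Suc.prems]] by simp
qed

lemma poly_deg_sum:
  "(\<And>a. a \<in> A \<Longrightarrow> poly_deg I m (f a)) \<Longrightarrow> poly_deg I m (\<lambda>x. \<Sum>a\<in>A. f a x)"
  by (induction A rule: infinite_finite_induct) (auto intro: poly_deg.intros)

lemma poly_deg_compose:
  assumes "poly_deg I m f" and "\<And>i. i \<in> I \<Longrightarrow> poly_deg J e (\<lambda>y. Y y i)"
  shows "poly_deg J (e * m) (\<lambda>y. f (Y y))"
  using assms(1)
proof (induction rule: poly_deg.induct)
  case (var_mult i m f)
  show ?case using poly_deg_mult[OF assms(2)[OF var_mult(1)] var_mult(3)] by simp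
qed (auto intro: poly_deg.intros)

lemma poly_deg_imp_poly_fun: "poly_deg I m f \<Longrightarrow> f \<in> poly_fun I"
  by (induction rule: poly_deg.induct) (auto intro: poly_fun.intros)

lemma poly_fun_imp_poly_deg: "f \<in> poly_fun I \<Longrightarrow> \<exists>m. poly_deg I m f"
proof (induction rule: poly_fun.induct)
  case (add f g)
  then obtain a b where "poly_deg I a f" "poly_deg I b g" by blast
  then have "poly_deg I (max a b) (\<lambda>x. f x + g x)"
    by (intro poly_deg.add) (auto elim: poly_deg_mono)
  then show ?case ..
next
  case (mult f g)
  then show ?case using poly_deg_mult by blast
qed (auto intro: poly_deg.intros poly_deg_var)

lemma poly_fun_cmult: "f \<in> poly_fun I \<Longrightarrow> (\<lambda>x. c * f x) \<in> poly_fun I"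
  by (rule poly_fun.mult[OF poly_fun.const])

lemma poly_fun_diff: "f \<in> poly_fun I \<Longrightarrow> g \<in> poly_fun I \<Longrightarrow> (\<lambda>x. f x - g x) \<in> poly_fun I"
  using poly_fun.add[OF _ poly_fun_cmult[of g I "-1"], of f] by simp

lemma poly_fun_power: "f \<in> poly_fun I \<Longrightarrow> (\<lambda>x. f x ^ j) \<in> poly_fun I"
  by (induction j) (auto intro: poly_fun.intros)

lemma poly_fun_sum:
  "(\<And>a. a \<in> A \<Longrightarrow> f a \<in> poly_fun I) \<Longrightarrow> (\<lambda>x. \<Sum>a\<in>A. f a x) \<in> poly_fun I"
  by (induction A rule: infinite_finite_induct) (auto intro: poly_fun.intros)

lemma poly_fun_prod:
  "(\<And>a. a \<in> A \<Longrightarrow> f a \<in> poly_fun I) \<Longrightarrow> (\<lambda>x. \<Prod>a\<in>A. f a x) \<in> poly_fun I"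
  by (induction A rule: infinite_finite_induct) (auto intro: poly_fun.intros)

lemma poly_fun_compose:
  assumes "f \<in> poly_fun I" and "\<And>i. i \<in> I \<Longrightarrow> (\<lambda>y. Y y i) \<in> poly_fun J"
  shows "(\<lambda>y. f (Y y)) \<in> poly_fun J"
  using assms(1) by (induction rule: poly_fun.induct) (auto intro: poly_fun.intros assms(2))

lemma poly_fun_cong:
  assumes "f \<in> poly_fun I" and "\<And>i. i \<in> I \<Longrightarrow> x i = y i"
  shows "f x = f y"
  using assms(1) by (induction rule: poly_fun.induct) (auto simp: assms(2))

section \<open>Restriction to lines, generic points and grids\<close>

lemma poly_deg_line:
  assumes "poly_deg I m f"
  shows "\<exists>P. degree P \<le> m \<and> (\<forall>t. f (\<lambda>v. a v + t * b v) = poly P t)"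
  using assms
proof (induction rule: poly_deg.induct)
  case (const m c)
  show ?case by (rule exI[of _ "[:c:]"]) simp
next
  case (var_mult i m f)
  then obtain P where P: "degree P \<le> m" "\<And>t. f (\<lambda>v. a v + t * b v) = poly P t" by blast
  have "degree ([:a i, b i:] * P) \<le> Suc m"
    using degree_mult_le[of "[:a i, b i:]" P] P(1) by (simp split: if_splits)
  then show ?case by (intro exI[of _ "[:a i, b i:] * P"]) (simp add: P(2) algebra_simps)
next
  case (add m f g)
  then obtain P Q where "degree P \<le> m" "\<And>t. f (\<lambda>v. a v + t * b v) = poly P t"
    "degree Q \<le> m" "\<And>t. g (\<lambda>v. a v + t * b v) = poly Q t" by blast
  then show ?case by (intro exI[of _ "P + Q"]) (simp add: degree_add_le)
qed

lemma poly_fun_line: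
  "f \<in> poly_fun I \<Longrightarrow> \<exists>P. \<forall>t. f (\<lambda>v. a v + t * b v) = poly P t"
  using poly_fun_imp_poly_deg poly_deg_line by blast

text \<open>On the line joining the two points both functions become nonzero univariate polynomials,
  whose product has only finitely many roots. This is the source of all generic choices
  below.\<close>

lemma poly_fun_nonzero_common:
  assumes "f \<in> poly_fun I" "g \<in> poly_fun I" "y0 \<in> aff J" "y1 \<in> aff J" "f y0 \<noteq> 0" "g y1 \<noteq> 0"
  shows "\<exists>y\<in>aff J. f y \<noteq> 0 \<and> g y \<noteq> 0"
proof -
  let ?l = "\<lambda>t v. y0 v + t * (y1 v - y0 v)"
  obtain P Q where P: "\<And>t. f (?l t) = poly P t" and Q: "\<And>t. g (?l t) = poly Q t"
    using poly_fun_line[of f I y0 "\<lambda>v. y1 v - y0 v"] poly_fun_line[of g I y0 "\<lambda>v. y1 v - y0 v"]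
      assms(1,2) by blast
  have "P \<noteq> 0" "Q \<noteq> 0" using P[of 0] Q[of 1] assms(5,6) by auto
  then have "finite {t. poly (P * Q) t = 0}" by (intro poly_roots_finite) simp
  then obtain t where "poly (P * Q) t \<noteq> 0"
    using infinite_UNIV_char_0[where 'a = complex] by (metis (mono_tags) UNIV_eq_I mem_Collect_eq)
  then show ?thesis using assms(3,4) P Q
    by (intro bexI[of _ "?l t"]) (auto simp: aff_def)
qed

lemma poly_fun_nonzero_finite:
  assumes "finite F" "F \<subseteq> poly_fun I" "\<And>f. f \<in> F \<Longrightarrow> \<exists>y\<in>aff J. f y \<noteq> 0"
  shows "\<exists>y\<in>aff J. \<forall>f\<in>F. f y \<noteq> 0"
  using assms
proof (induction F rule: finite_induct)
  case empty
  have "(\<lambda>_. 0) \<in> aff J" by (simp add: aff_def)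
  then show ?case by auto
next
  case (insert f F)
  then obtain y0 y1 where y: "y0 \<in> aff J" "f y0 \<noteq> 0" "y1 \<in> aff J" "\<forall>f\<in>F. f y1 \<noteq> 0"
    by (metis insert_iff insert_subset)
  have "(\<lambda>y. \<Prod>f\<in>F. f y) \<in> poly_fun I" using insert.prems by (intro poly_fun_prod) auto
  then obtain y where "y \<in> aff J" "f y \<noteq> 0" "(\<Prod>f\<in>F. f y) \<noteq> 0"
    using poly_fun_nonzero_common[of f I "\<lambda>y. \<Prod>f\<in>F. f y" y0 J y1] insert y by auto
  then show ?case using insert.hyps(1) by (intro bexI[of _ y]) auto
qed

lemma poly_deg_grid_zero:
  assumes "finite J" "poly_deg I m f"
    and "\<And>y. (\<And>v. v \<in> J \<Longrightarrow> y v \<in> of_nat ` {..m}) \<Longrightarrow> (\<And>v. v \<notin> J \<Longrightarrow> y v = z v) \<Longrightarrow> f y = 0"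
    and "\<And>v. v \<notin> J \<Longrightarrow> y v = z v"
  shows "f y = 0"
  using assms(1,3,4)
proof (induction J arbitrary: z y rule: finite_induct)
  case empty
  then show ?case by simp
next
  case (insert j J)
  \<comment> \<open>The induction hypothesis is used with coordinate \<open>j\<close> frozen at a
    grid value, which is why \<open>z\<close> has to be arbitrary.\<close>
  have grid: "f (y(j := of_nat k)) = 0" if "k \<le> m" for k
  proof (rule insert.IH[of "y(j := of_nat k)" "y(j := of_nat k)"])
    fix y' assume y': "\<And>v. v \<in> J \<Longrightarrow> y' v \<in> of_nat ` {..m}"
      "\<And>v. v \<notin> J \<Longrightarrow> y' v = (y(j := of_nat k)) v"
    show "f y' = 0"
    proof (rule insert.prems(1))
      show "y' v \<in> of_nat ` {..m}" if "v \<in> insert j J" for v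
        using that y' insert.hyps(2) \<open>k \<le> m\<close> by (cases "v = j") auto
      show "y' v = z v" if "v \<notin> insert j J" for v
        using that y'(2)[of v] insert.prems(2)[of v] by auto
    qed
  qed auto
  obtain P where P: "degree P \<le> m"
    "\<And>t. f (\<lambda>v. (y(j := 0)) v + t * (if v = j then 1 else 0)) = poly P t"
    using poly_deg_line[OF assms(2), of "y(j := 0)" "\<lambda>v. if v = j then 1 else 0"] by blast
  have upd: "(\<lambda>v. (y(j := 0)) v + t * (if v = j then 1 else 0)) = y(j := t)" for t
    by auto
  have P': "f (y(j := t)) = poly P t" for t using P(2)[of t] unfolding upd .
  have "P = 0"
  proof (rule ccontr)
    assume "P \<noteq> 0"
    have "of_nat ` {..m} \<subseteq> {t. poly P t = 0}" using grid P' by auto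
    then have "card (of_nat ` {..m} :: complex set) \<le> degree P"
      using card_mono[OF poly_roots_finite[OF \<open>P \<noteq> 0\<close>]] card_poly_roots_bound[OF \<open>P \<noteq> 0\<close>]
      by (meson order_trans)
    then show False using P(1) by (simp add: card_image inj_on_def)
  qed
  then show ?case using P'[of "y j"] by simp
qed

section \<open>Irreducible sets and chains\<close>

text \<open>Gaussian elimination: an equation with a nonzero coefficient at \<open>b0\<close>
  removes itself and the unknown \<open>b0\<close>, so the gap between the two cardinalities
  persists.\<close>

lemma homogeneous_system:
  fixes M :: "'a \<Rightarrow> 'b \<Rightarrow> complex"
  assumes "finite A" "finite B" "card A < card B"
  shows "\<exists>c. (\<exists>b\<in>B. c b \<noteq> 0) \<and> (\<forall>a\<in>A. (\<Sum>b\<in>B. M a b * c b) = 0)"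
  using assms
proof (induction A arbitrary: B M rule: finite_induct)
  case empty
  then have "B \<noteq> {}" by auto
  then show ?case by (intro exI[of _ "\<lambda>_. 1"]) auto
next
  case (insert a A)
  show ?case
  proof (cases "\<forall>b\<in>B. M a b = 0")
    case True
    obtain c where "\<exists>b\<in>B. c b \<noteq> 0" "\<forall>a\<in>A. (\<Sum>b\<in>B. M a b * c b) = 0"
      using insert.IH[of B M] insert.prems insert.hyps by auto
    with True show ?thesis by (intro exI[of _ c]) auto
  next
    case False
    then obtain b0 where b0: "b0 \<in> B" "M a b0 \<noteq> 0" by blast
    define B' where "B' = B - {b0}"
    have B: "B = insert b0 B'" "b0 \<notin> B'" "finite B'" using b0 insert.prems by (auto simp: B'_def)
    have "card A < card B'" using insert.prems insert.hyps B by simp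
    then obtain c where c: "\<exists>b\<in>B'. c b \<noteq> 0"
      "\<And>i. i \<in> A \<Longrightarrow> (\<Sum>b\<in>B'. (M i b - M i b0 * M a b / M a b0) * c b) = 0"
      using insert.IH[of B' "\<lambda>i b. M i b - M i b0 * M a b / M a b0"] B(3) by blast
    \<comment> \<open>The value at \<open>b0\<close> is the one that equation \<open>a\<close>
      forces.\<close>
    define c' where "c' = c(b0 := - (\<Sum>b\<in>B'. M a b * c b) / M a b0)"
    have eq: "(\<Sum>b\<in>B'. M i b * c' b) = (\<Sum>b\<in>B'. M i b * c b)" for i
      using B(2) by (intro sum.cong) (auto simp: c'_def)
    have "(\<Sum>b\<in>B. M i b * c' b) = 0" if "i \<in> insert a A" for i
    proof (cases "i = a")
      case True
      then show ?thesis using B b0(2) by (simp add: eq) (simp add: c'_def)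
    next
      case False
      then have "(\<Sum>b\<in>B'. M i b * c b) - M i b0 / M a b0 * (\<Sum>b\<in>B'. M a b * c b) = 0"
        using c(2)[of i] that by (simp add: sum_subtractf sum_distrib_left algebra_simps)
      then show ?thesis using B by (simp add: eq) (simp add: c'_def)
    qed
    moreover have "\<exists>b\<in>B. c' b \<noteq> 0" using c(1) B by (auto simp: c'_def)
    ultimately show ?thesis by blast
  qed
qed

text \<open>The vanishing ideal of \<open>X\<close> is prime. Since \<open>X\<close> need not be
  closed, this applies to images of parametrizations before their closure is taken.\<close>

definition prime_on :: "'v set \<Rightarrow> ('v \<Rightarrow> complex) set \<Rightarrow> bool" where
  "prime_on I X \<longleftrightarrow> X \<noteq> {} \<and>
     (\<forall>f\<in>poly_fun I. \<forall>g\<in>poly_fun I. (\<forall>x\<in>X. f x * g x = 0) \<longrightarrow>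
        (\<forall>x\<in>X. f x = 0) \<or> (\<forall>x\<in>X. g x = 0))"

lemma prime_onD:
  "prime_on I X \<Longrightarrow> f \<in> poly_fun I \<Longrightarrow> g \<in> poly_fun I \<Longrightarrow> \<forall>x\<in>X. f x * g x = 0 \<Longrightarrow>
    (\<forall>x\<in>X. f x = 0) \<or> (\<forall>x\<in>X. g x = 0)"
  by (simp add: prime_on_def)

section \<open>Zariski closure and irreducibility through vanishing ideals\<close>

definition zclosure :: "'v set \<Rightarrow> ('v \<Rightarrow> complex) set \<Rightarrow> ('v \<Rightarrow> complex) set" where
  "zclosure I X = {x \<in> aff I. \<forall>f\<in>poly_fun I. (\<forall>z\<in>X. f z = 0) \<longrightarrow> f x = 0}"

lemma zclosure_superset: "X \<subseteq> aff I \<Longrightarrow> X \<subseteq> zclosure I X"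
  by (auto simp: zclosure_def)

lemma zclosure_mono: "X \<subseteq> Y \<Longrightarrow> zclosure I X \<subseteq> zclosure I Y"
  by (auto simp: zclosure_def)

lemma zclosure_minimal: "zariski_closed I Y \<Longrightarrow> X \<subseteq> Y \<Longrightarrow> zclosure I X \<subseteq> Y"
  unfolding zariski_closed_def zclosure_def by blast

lemma zariski_closed_zclosure: "zariski_closed I (zclosure I X)"
  unfolding zariski_closed_def zclosure_def
  by (rule exI[of _ "{f \<in> poly_fun I. \<forall>z\<in>X. f z = 0}"]) auto

lemma zariski_closed_subset: "zariski_closed I S \<Longrightarrow> S \<subseteq> aff I"
  by (auto simp: zariski_closed_def)

lemma zariski_closed_separate:
  assumes "zariski_closed I S" "x \<in> aff I" "x \<notin> S"
  shows "\<exists>f\<in>poly_fun I. (\<forall>z\<in>S. f z = 0) \<and> f x \<noteq> 0"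
  using assms unfolding zariski_closed_def by blast

lemma prime_on_imp_irreducible:
  assumes "prime_on I S" "zariski_closed I S"
  shows "zariski_irreducible I S"
  unfolding zariski_irreducible_def
proof (intro conjI allI impI)
  fix A B assume AB: "zariski_closed I A" "zariski_closed I B" "S = A \<union> B"
  show "S = A \<or> S = B"
  proof (rule ccontr)
    assume "\<not> (S = A \<or> S = B)"
    then obtain x y where xy: "x \<in> S" "x \<notin> A" "y \<in> S" "y \<notin> B" using AB by blast
    then obtain f g where fg: "f \<in> poly_fun I" "\<forall>z\<in>A. f z = 0" "f x \<noteq> 0"
      "g \<in> poly_fun I" "\<forall>z\<in>B. g z = 0" "g y \<noteq> 0"
      using zariski_closed_separate[OF AB(1), of x] zariski_closed_separate[OF AB(2), of y]
        zariski_closed_subset[OF assms(2)] by blast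
    have "\<forall>z\<in>S. f z * g z = 0" using fg AB(3) by auto
    then show False using assms(1) fg xy unfolding prime_on_def by blast
  qed
qed (use assms in \<open>auto simp: prime_on_def\<close>)

lemma irreducible_imp_prime_on:
  assumes "zariski_irreducible I S"
  shows "prime_on I S"
  unfolding prime_on_def
proof (intro conjI ballI impI)
  fix f g assume fg: "f \<in> poly_fun I" "g \<in> poly_fun I" "\<forall>x\<in>S. f x * g x = 0"
  obtain F where F: "F \<subseteq> poly_fun I" "S = {x \<in> aff I. \<forall>f\<in>F. f x = 0}"
    using assms unfolding zariski_irreducible_def zariski_closed_def by blast
  have "zariski_closed I {x \<in> S. h x = 0}" if "h \<in> poly_fun I" for h
    unfolding zariski_closed_def using F that by (intro exI[of _ "insert h F"]) auto
  moreover have "S = {x \<in> S. f x = 0} \<union> {x \<in> S. g x = 0}" using fg(3) by auto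
  ultimately have "S = {x \<in> S. f x = 0} \<or> S = {x \<in> S. g x = 0}"
    using assms fg(1,2) unfolding zariski_irreducible_def by meson
  then show "(\<forall>x\<in>S. f x = 0) \<or> (\<forall>x\<in>S. g x = 0)" by blast
qed (use assms in \<open>auto simp: zariski_irreducible_def\<close>)

lemma prime_on_zclosure_irreducible:
  assumes "prime_on I X" "X \<subseteq> aff I"
  shows "zariski_irreducible I (zclosure I X)"
proof (rule prime_on_imp_irreducible[OF _ zariski_closed_zclosure])
  have sub: "X \<subseteq> zclosure I X" by (rule zclosure_superset[OF assms(2)])
  have "(\<forall>x\<in>zclosure I X. f x = 0) \<longleftrightarrow> (\<forall>x\<in>X. f x = 0)" if "f \<in> poly_fun I" for f
    using that sub by (auto simp: zclosure_def)
  then show "prime_on I (zclosure I X)"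
    using assms(1) sub poly_fun.mult unfolding prime_on_def by (smt (verit) subset_empty subsetD)
qed

text \<open>Otherwise each \<open>C a\<close> has a function that vanishes on it but not on
  \<open>V\<close>. By primality their product is nonzero at some point of \<open>V\<close>, yet
  that point lies in some \<open>C a\<close>.\<close>

lemma irreducible_covered:
  assumes "zariski_irreducible I V" "finite A" "V \<subseteq> (\<Union>a\<in>A. C a)"
    and "\<And>a. a \<in> A \<Longrightarrow> zariski_closed I (C a)"
  shows "\<exists>a\<in>A. V \<subseteq> C a"
proof (rule ccontr)
  assume neg: "\<not> ?thesis"
  have V: "prime_on I V" "V \<subseteq> aff I"
    using irreducible_imp_prime_on[OF assms(1)] zariski_closed_subset[of I V] assms(1)
    unfolding zariski_irreducible_def by blast+
  have "\<exists>f\<in>poly_fun I. (\<forall>z\<in>C a. f z = 0) \<and> (\<exists>x\<in>V. f x \<noteq> 0)" if a: "a \<in> A" for a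
  proof -
    obtain x where "x \<in> V" "x \<notin> C a" using neg a by blast
    then show ?thesis using zariski_closed_separate[OF assms(4)[OF a], of x] V(2) by blast
  qed
  then obtain f where f: "\<And>a. a \<in> A \<Longrightarrow> f a \<in> poly_fun I"
    "\<And>a z. a \<in> A \<Longrightarrow> z \<in> C a \<Longrightarrow> f a z = 0" "\<And>a. a \<in> A \<Longrightarrow> \<exists>x\<in>V. f a x \<noteq> 0" by metis
  have "\<exists>x\<in>V. (\<Prod>a\<in>B. f a x) \<noteq> 0" if "B \<subseteq> A" for B
    using finite_subset[OF that assms(2)] that
  proof (induction B rule: finite_induct)
    case empty
    then show ?case using V(1) by (auto simp: prime_on_def)
  next
    case (insert b B)
    have "(\<lambda>x. \<Prod>a\<in>B. f a x) \<in> poly_fun I" using insert.prems f(1) by (intro poly_fun_prod) auto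
    then have "\<exists>x\<in>V. f b x * (\<Prod>a\<in>B. f a x) \<noteq> 0"
      using V(1) f(1,3)[of b] insert unfolding prime_on_def
      by (smt (verit) insert_subset)
    then show ?case using insert.hyps by simp
  qed
  then obtain x where x: "x \<in> V" "(\<Prod>a\<in>A. f a x) \<noteq> 0" by blast
  then obtain a where "a \<in> A" "x \<in> C a" using assms(3) by blast
  then show False using x(2) assms(2) f(2)[of a x] by (auto simp: prod_zero_iff)
qed

text \<open>On \<open>Z\<close> the relation reduces to its term \<open>g 0\<close>, which therefore
  vanishes on \<open>Z\<close> and then on \<open>W\<close>. Primality allows cancelling one factor
  \<open>f\<close> from the rest, and the argument repeats.\<close>

lemma power_coeffs_vanish:
  assumes W: "prime_on I W" and "f \<in> poly_fun I" "\<exists>x\<in>W. f x \<noteq> 0"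
    and "Z \<subseteq> W" "\<And>x. x \<in> Z \<Longrightarrow> f x = 0" "\<And>j. g j \<in> poly_fun I"
    and "\<And>j. \<forall>x\<in>Z. g j x = 0 \<Longrightarrow> \<forall>x\<in>W. g j x = 0"
    and "\<forall>x\<in>W. (\<Sum>j<D. f x ^ j * g j x) = 0" "j < D"
  shows "\<forall>x\<in>Z. g j x = 0"
  using assms(6-)
proof (induction D arbitrary: g j)
  case (Suc D)
  have head: "(\<Sum>j<Suc D. f x ^ j * g j x) = g 0 x + f x * (\<Sum>j<D. f x ^ j * g (Suc j) x)" for x
    by (simp add: sum.lessThan_Suc_shift sum_distrib_left mult.assoc del: sum.lessThan_Suc)
  have Z0: "\<forall>x\<in>Z. g 0 x = 0"
  proof
    fix x assume "x \<in> Z"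
    then have "f x = 0" "(\<Sum>j<Suc D. f x ^ j * g j x) = 0" using assms(4,5) Suc.prems(3) by blast+
    then show "g 0 x = 0" unfolding head by simp
  qed
  then have "\<forall>x\<in>W. g 0 x = 0" using Suc.prems(2) by blast
  then have "\<forall>x\<in>W. f x * (\<Sum>j<D. f x ^ j * g (Suc j) x) = 0"
    using Suc.prems(3) by (simp add: head del: sum.lessThan_Suc)
  moreover have "(\<lambda>x. \<Sum>j<D. f x ^ j * g (Suc j) x) \<in> poly_fun I"
    by (intro poly_fun_sum poly_fun.mult poly_fun_power Suc.prems assms)
  ultimately have "\<forall>x\<in>W. (\<Sum>j<D. f x ^ j * g (Suc j) x) = 0"
    using prime_onD[OF W assms(2)] assms(3) by blast
  then have "\<forall>x\<in>Z. g (Suc i) x = 0" if "i < D" for i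
    using Suc.IH[of "\<lambda>j. g (Suc j)" i] Suc.prems(1,2) that by blast
  then show ?case using Z0 Suc.prems(4) by (cases j) auto
qed simp

text \<open>Exponent vectors of monomials in \<open>r\<close> functions with all exponents below
  \<open>D\<close>; each larger set of the chain prepends the exponent of its new function.\<close>

abbreviation box :: "nat \<Rightarrow> nat \<Rightarrow> nat list set" where
  "box r D \<equiv> {xs. set xs \<subseteq> {..<D} \<and> length xs = r}"

lemma box_Suc: "box (Suc r) D = (\<lambda>(j, a). j # a) ` ({..<D} \<times> box r D)"
  by (force simp: length_Suc_conv image_iff)

text \<open>If f cuts out a proper closed subset containing \<open>Z\<close> of an irreducible \<open>W\<close>, then f is
  algebraically independent on \<open>W\<close> of all functions that are independent on \<open>Z\<close>. A chain therefore
  yields as many independent monomials as there are in a box.\<close>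

lemma chain_independent:
  assumes "\<forall>i\<le>r. zariski_irreducible I (Z i)" "\<forall>i<r. Z i \<subset> Z (Suc i)"
  shows "\<exists>e. \<forall>D. \<exists>h. (\<forall>a\<in>box r D. poly_deg I (e * D) (h a)) \<and>
    (\<forall>c. (\<forall>x\<in>Z r. (\<Sum>a\<in>box r D. c a * h a x) = 0) \<longrightarrow> (\<forall>a\<in>box r D. c a = 0))"
  using assms
proof (induction r)
  case 0
  then have "Z 0 \<noteq> {}" by (auto simp: zariski_irreducible_def)
  moreover have "box 0 D = {[]}" for D by auto
  ultimately show ?case
    by (intro exI[of _ 0] allI exI[of _ "\<lambda>_ _. 1"]) (auto intro: poly_deg.intros)
next
  case (Suc r)
  obtain e where e: "\<And>D. \<exists>h. (\<forall>a\<in>box r D. poly_deg I (e * D) (h a)) \<and>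
    (\<forall>c. (\<forall>x\<in>Z r. (\<Sum>a\<in>box r D. c a * h a x) = 0) \<longrightarrow> (\<forall>a\<in>box r D. c a = 0))"
    using Suc by auto
  have irr: "zariski_irreducible I (Z r)" "zariski_irreducible I (Z (Suc r))"
    and sub: "Z r \<subset> Z (Suc r)" using Suc.prems by auto
  obtain x1 where x1: "x1 \<in> Z (Suc r)" "x1 \<notin> Z r" using sub by blast
  then obtain f where f: "f \<in> poly_fun I" "\<forall>z\<in>Z r. f z = 0" "f x1 \<noteq> 0"
    using zariski_closed_separate[of I "Z r" x1] irr zariski_closed_subset
    by (auto simp: zariski_irreducible_def)
  obtain m where m: "poly_deg I m f" using poly_fun_imp_poly_deg[OF f(1)] by blast
  show ?case
  \<comment> \<open>Each new function contributes its degree \<open>m\<close> at most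
    \<open>D\<close> times, so the degree bound stays linear in \<open>D\<close>; the later count
    rests on this.\<close>
  proof (intro exI[of _ "m + e"] allI)
    fix D
    obtain h where h: "\<And>a. a \<in> box r D \<Longrightarrow> poly_deg I (e * D) (h a)"
      "\<And>c. (\<forall>x\<in>Z r. (\<Sum>a\<in>box r D. c a * h a x) = 0) \<Longrightarrow> \<forall>a\<in>box r D. c a = 0"
      using e[of D] by blast
    define h' where "h' = (\<lambda>xs x. f x ^ hd xs * h (tl xs) x)"
    have "poly_deg I ((m + e) * D) (h' xs)" if mem: "xs \<in> box (Suc r) D" for xs
    proof -
      obtain j a where xs: "xs = j # a" "j < D" "a \<in> box r D" using mem unfolding box_Suc by auto
      have "poly_deg I (m * j + e * D) (\<lambda>x. f x ^ j * h a x)"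
        by (rule poly_deg_mult[OF poly_deg_power[OF m] h(1)[OF xs(3)]])
      moreover have "m * j + e * D \<le> (m + e) * D" using xs(2) by (simp add: distrib_right)
      ultimately show ?thesis unfolding h'_def xs(1) by (auto elim: poly_deg_mono)
    qed
    moreover have "\<forall>xs\<in>box (Suc r) D. c xs = 0"
      if c: "\<forall>x\<in>Z (Suc r). (\<Sum>xs\<in>box (Suc r) D. c xs * h' xs x) = 0" for c
    proof -
      define g where "g = (\<lambda>j x. \<Sum>a\<in>box r D. c (j # a) * h a x)"
      have "(\<Sum>xs\<in>box (Suc r) D. c xs * h' xs x) = (\<Sum>j<D. f x ^ j * g j x)" for x
      proof -
        have "(\<Sum>xs\<in>box (Suc r) D. c xs * h' xs x)
            = (\<Sum>(j, a)\<in>{..<D} \<times> box r D. c (j # a) * (f x ^ j * h a x))"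
          unfolding box_Suc by (subst sum.reindex) (auto simp: inj_on_def h'_def intro!: sum.cong)
        also have "\<dots> = (\<Sum>j<D. \<Sum>a\<in>box r D. c (j # a) * (f x ^ j * h a x))"
          by (rule sum.cartesian_product[symmetric])
        also have "\<dots> = (\<Sum>j<D. f x ^ j * g j x)"
          by (simp add: g_def sum_distrib_left mult_ac)
        finally show ?thesis .
      qed
      then have van: "\<forall>x\<in>Z (Suc r). (\<Sum>j<D. f x ^ j * g j x) = 0" using c by simp
      have gpoly: "g j \<in> poly_fun I" for j
        unfolding g_def using h(1) by (intro poly_fun_sum poly_fun_cmult) (auto dest: poly_deg_imp_poly_fun)
      have g0: "\<forall>a\<in>box r D. c (j # a) = 0" if "\<forall>x\<in>Z r. g j x = 0" for j
        using h(2)[of "\<lambda>a. c (j # a)"] that unfolding g_def by blast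
      \<comment> \<open>Independence on the smaller set makes the coefficients of \<open>g j\<close>
        zero, so \<open>g j\<close> is zero everywhere and in particular on the larger set.\<close>
      have gW: "\<forall>x\<in>Z (Suc r). g j x = 0" if "\<forall>x\<in>Z r. g j x = 0" for j
        using g0[OF that] by (auto simp: g_def intro!: sum.neutral)
      have "\<forall>x\<in>Z r. g j x = 0" if "j < D" for j
        using power_coeffs_vanish[OF irreducible_imp_prime_on[OF irr(2)] f(1) _ _ _ gpoly gW van that]
          x1 f(2,3) sub by blast
      then show ?thesis using g0 unfolding box_Suc by auto
    qed
    ultimately show "\<exists>h. (\<forall>a\<in>box (Suc r) D. poly_deg I ((m + e) * D) (h a)) \<and>
      (\<forall>c. (\<forall>x\<in>Z (Suc r). (\<Sum>a\<in>box (Suc r) D. c a * h a x) = 0) \<longrightarrow> (\<forall>a\<in>box (Suc r) D. c a = 0))"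
      by (intro exI[of _ h']) blast
  qed
qed

section \<open>Linear independence of square roots\<close>

text \<open>Subtracting \<open>smult c q\<close> kills the coefficient of \<open>p\<close> at
  \<open>degree q\<close> and keeps the equation. For a nonzero difference \<open>r\<close>,
  comparing leading coefficients would give \<open>degree r = degree q\<close>, where its
  coefficient is zero.\<close>

lemma wronskian_zero:
  fixes p q :: "complex poly"
  assumes "p * pderiv q = pderiv p * q" "q \<noteq> 0"
  shows "\<exists>c. p = smult c q"
proof -
  define c where "c = coeff p (degree q) / lead_coeff q"
  define r where "r = p - smult c q"
  have cr: "coeff r (degree q) = 0" using assms(2) by (simp add: r_def c_def)
  have W: "r * pderiv q = pderiv r * q"
    using assms(1) by (simp add: r_def pderiv_diff pderiv_smult algebra_simps)
  have "r = 0"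
  proof (rule ccontr)
    assume r: "r \<noteq> 0"
    then have deg: "degree r \<noteq> degree q" using cr by (metis leading_coeff_0_iff)
    have lead: "lead_coeff (pderiv s) = of_nat (degree s) * lead_coeff s" for s :: "complex poly"
      by (cases "degree s") (auto simp: coeff_pderiv degree_pderiv coeff_eq_0)
    have "lead_coeff r * lead_coeff (pderiv q) = lead_coeff (pderiv r) * lead_coeff q"
      using W by (metis lead_coeff_mult)
    then show False using deg r assms(2) by (simp add: lead)
  qed
  then show ?thesis by (auto simp: r_def)
qed

lemma poly_eq_0_on_open:
  fixes P :: "complex poly"
  assumes "open B" "B \<noteq> {}" "\<And>t. t \<in> B \<Longrightarrow> poly P t = 0"
  shows "P = 0"
proof (rule ccontr)
  assume "P \<noteq> 0"
  then have "finite B" using finite_subset[OF _ poly_roots_finite] assms(3) by blast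
  then show False using assms(1,2) finite_imp_not_open by blast
qed

text \<open>The derivative of a square root is a rational multiple of that root, so differentiating
  a relation between roots gives a relation between the same roots.\<close>

lemma sqrt_derivative:
  assumes "open B" "u holomorphic_on B" "\<And>t. t \<in> B \<Longrightarrow> u t ^ 2 = poly h t" "t \<in> B"
  shows "2 * poly h t * deriv u t = poly (pderiv h) t * u t"
proof -
  have u: "(u has_field_derivative deriv u t) (at t)"
    using holomorphic_derivI[OF assms(2,1,4)] .
  have "((\<lambda>t. u t ^ 2) has_field_derivative 2 * u t * deriv u t) (at t)"
    by (rule derivative_eq_intros u | simp)+
  then have "(poly h has_field_derivative 2 * u t * deriv u t) (at t)"
    by (rule has_field_derivative_transform_within_open[OF _ assms(1,4)]) (rule assms(3))
  then have "2 * u t * deriv u t = poly (pderiv h) t"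
    using DERIV_unique poly_DERIV by blast
  moreover have "2 * poly h t * deriv u t = 2 * u t * deriv u t * u t"
    using assms(3)[OF assms(4), symmetric] by (simp add: power2_eq_square)
  ultimately show ?thesis by simp
qed

text \<open>Eliminating one term between the relation and its derivative gives a shorter relation;
  if that one is trivial then two terms are proportional by the Wronskian criterion.\<close>

lemma sqrt_independent:
  fixes h :: "'i \<Rightarrow> complex poly" and u :: "'i \<Rightarrow> complex \<Rightarrow> complex"
  assumes "finite A" and B: "open B" "B \<noteq> {}"
    and "\<And>i. i \<in> A \<Longrightarrow> u i holomorphic_on B"
    and "\<And>i t. i \<in> A \<Longrightarrow> t \<in> B \<Longrightarrow> u i t ^ 2 = poly (h i) t"
    and "\<And>i. i \<in> A \<Longrightarrow> h i \<noteq> 0"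
    and "\<And>i j P Q c. i \<in> A \<Longrightarrow> j \<in> A \<Longrightarrow> i \<noteq> j \<Longrightarrow> P \<noteq> 0 \<Longrightarrow> Q \<noteq> 0 \<Longrightarrow>
           P\<^sup>2 * h i \<noteq> smult c (Q\<^sup>2 * h j)"
    and "\<And>t. t \<in> B \<Longrightarrow> (\<Sum>i\<in>A. poly (Q i) t * u i t) = 0"
  shows "\<forall>i\<in>A. Q i = 0"
  using assms(1,4-)
proof (induction A arbitrary: Q rule: finite_induct)
  case (insert k A)
  have hol: "u i holomorphic_on B" and sq: "\<And>t. t \<in> B \<Longrightarrow> u i t ^ 2 = poly (h i) t"
    and h0: "h i \<noteq> 0" if "i \<in> insert k A" for i
    using insert.prems(1-3) that by blast+
  have IH: "\<forall>i\<in>A. Q' i = 0" if "\<And>t. t \<in> B \<Longrightarrow> (\<Sum>i\<in>A. poly (Q' i) t * u i t) = 0" for Q'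
    by (rule insert.IH) (rule insert.prems(1-4) that; simp)+
  show ?case
  proof (cases "Q k = 0")
    case True
    then have "(\<Sum>i\<in>A. poly (Q i) t * u i t) = 0" if "t \<in> B" for t
      using insert.prems(5)[OF that] insert.hyps by simp
    then have "\<forall>i\<in>A. Q i = 0" by (rule IH)
    then show ?thesis using True by simp
  next
    case False
    define H where "H = (\<Prod>i\<in>insert k A. h i)"
    \<comment> \<open>The derivative of \<open>Q i * u i\<close> is \<open>N i / (2 * h i)\<close>
      times \<open>u i\<close>; multiplying by \<open>2 * H\<close> clears all denominators and
      leaves the coefficient \<open>D i\<close>.\<close>
    define N where "N = (\<lambda>i. 2 * pderiv (Q i) * h i + Q i * pderiv (h i))"
    define D where "D = (\<lambda>i. N i * (\<Prod>j\<in>insert k A - {i}. h j))"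
    have H0: "H \<noteq> 0" unfolding H_def using insert.hyps(1) h0 by (simp add: prod_zero_iff)
    have DH: "D i * h i = N i * H" if "i \<in> insert k A" for i
      unfolding D_def H_def using prod.remove[OF _ that, of h] insert.hyps(1) by (simp add: mult_ac)
    have rel: "(\<Sum>i\<in>insert k A. poly (D i) t * u i t) = 0" if t: "t \<in> B" for t
    proof -
      have du: "(u i has_field_derivative deriv (u i) t) (at t)" if "i \<in> insert k A" for i
        using holomorphic_derivI[OF hol[OF that] B(1) t] .
      let ?d = "\<lambda>i. poly (pderiv (Q i)) t * u i t + poly (Q i) t * deriv (u i) t"
      have "((\<lambda>t. \<Sum>i\<in>insert k A. poly (Q i) t * u i t) has_field_derivative
          (\<Sum>i\<in>insert k A. ?d i)) (at t)"
        by (intro DERIV_sum) (auto intro!: derivative_eq_intros du)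
      then have "((\<lambda>t. 0) has_field_derivative (\<Sum>i\<in>insert k A. ?d i)) (at t)"
        by (rule has_field_derivative_transform_within_open[OF _ B(1) t]) (rule insert.prems(5))
      then have "(\<Sum>i\<in>insert k A. ?d i) = 0" using DERIV_unique DERIV_const by blast
      then have "0 = (\<Sum>i\<in>insert k A. 2 * poly H t * ?d i)"
        by (simp flip: sum_distrib_left)
      also have "\<dots> = (\<Sum>i\<in>insert k A. poly (D i) t * u i t)"
      proof (rule sum.cong[OF refl])
        fix i assume i: "i \<in> insert k A"
        let ?r = "\<Prod>j\<in>insert k A - {i}. h j"
        have Hi: "H = h i * ?r" unfolding H_def using prod.remove[OF _ i] insert.hyps(1) by blast
        have "2 * poly H t * ?d i = poly ?r t * (2 * poly (h i) t * poly (pderiv (Q i)) t * u i t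
            + poly (Q i) t * (2 * poly (h i) t * deriv (u i) t))"
          unfolding Hi by (simp add: algebra_simps)
        also have "2 * poly (h i) t * deriv (u i) t = poly (pderiv (h i)) t * u i t"
          by (rule sqrt_derivative[OF B(1) hol[OF i] sq[OF i] t])
        finally show "2 * poly H t * ?d i = poly (D i) t * u i t"
          by (simp add: D_def N_def algebra_simps)
      qed
      finally show ?thesis by simp
    qed
    \<comment> \<open>This combination of the derived and the original relation has no term at
      \<open>k\<close>.\<close>
    have "\<forall>i\<in>A. Q k * D i - D k * Q i = 0"
    proof (rule IH)
      fix t assume t: "t \<in> B"
      have "0 = poly (Q k) t * (\<Sum>i\<in>insert k A. poly (D i) t * u i t)
          - poly (D k) t * (\<Sum>i\<in>insert k A. poly (Q i) t * u i t)"
        using rel[OF t] insert.prems(5)[OF t] by simp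
      also have "\<dots> = (\<Sum>i\<in>insert k A. poly (Q k * D i - D k * Q i) t * u i t)"
        by (simp only: sum_distrib_left sum_subtractf[symmetric] poly_diff poly_mult)
          (rule sum.cong[OF refl], simp add: algebra_simps)
      also have "\<dots> = (\<Sum>i\<in>A. poly (Q k * D i - D k * Q i) t * u i t)"
        using insert.hyps by simp
      finally show "(\<Sum>i\<in>A. poly (Q k * D i - D k * Q i) t * u i t) = 0" by simp
    qed
    then have QD: "Q k * D i = D k * Q i" if "i \<in> A" for i using that by auto
    have QA: "Q i = 0" if i: "i \<in> A" for i
    proof (rule ccontr)
      assume Qi: "Q i \<noteq> 0"
      have "Q k * h k * (D i * h i) = (D k * h k) * Q i * h i" using QD[OF i] by (simp add: mult_ac)
      then have "H * (Q k * h k * N i) = H * (N k * Q i * h i)"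
        using DH i by (simp add: mult_ac)
      then have NN: "Q k * h k * N i = N k * Q i * h i" using H0 by simp
      have pd: "pderiv ((Q j)\<^sup>2 * h j) = Q j * N j" for j
        by (simp add: N_def pderiv_mult power2_eq_square algebra_simps)
      \<comment> \<open>\<open>NN\<close> says that the squares of the two terms have equal
        logarithmic derivatives, which makes their Wronskian zero.\<close>
      have "(Q i)\<^sup>2 * h i * pderiv ((Q k)\<^sup>2 * h k) = pderiv ((Q i)\<^sup>2 * h i) * ((Q k)\<^sup>2 * h k)"
        unfolding pd using arg_cong[OF NN[symmetric], of "\<lambda>z. Q i * Q k * z"]
        by (simp add: power2_eq_square mult_ac)
      then obtain c where "(Q i)\<^sup>2 * h i = smult c ((Q k)\<^sup>2 * h k)"
        using wronskian_zero False h0[of k] by (metis insertI1 mult_eq_0_iff power_not_zero)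
      then show False using insert.prems(4)[of i k "Q i" "Q k" c] i insert.hyps Qi False by auto
    qed
    have "poly ((Q k)\<^sup>2 * h k) t = 0" if t: "t \<in> B" for t
    proof -
      have "poly (Q k) t * u k t = 0" using insert.prems(5)[OF t] insert.hyps QA by simp
      then have "(poly (Q k) t * u k t)\<^sup>2 = 0" by simp
      then show ?thesis using sq[of k t] t by (simp add: power_mult_distrib)
    qed
    then have "(Q k)\<^sup>2 * h k = 0" by (intro poly_eq_0_on_open[OF B])
    then show ?thesis using False h0[of k] by simp
  qed
qed simp

section \<open>Parity of orders for products of linear factors\<close>

lemma order_square_times:
  fixes P g :: "complex poly"
  assumes "P \<noteq> 0" "g \<noteq> 0"
  shows "order r (P\<^sup>2 * g) = 2 * order r P + order r g"
  using assms by (simp add: order_mult power2_eq_square)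

lemma order_linear_prod:
  fixes h :: "'e \<Rightarrow> complex poly"
  assumes "finite S" "\<And>e. e \<in> S \<Longrightarrow> h e = [:\<alpha> e, \<beta> e:]" "\<And>e. e \<in> S \<Longrightarrow> \<beta> e \<noteq> 0"
  shows "order r (\<Prod>e\<in>S. h e) = card {e \<in> S. poly (h e) r = 0}"
  using assms
proof (induction S rule: finite_induct)
  case empty
  then show ?case by (simp add: order_0I)
next
  case (insert e S)
  have he: "h e = [:\<alpha> e, \<beta> e:]" "\<beta> e \<noteq> 0" using insert.prems by auto
  have nz: "(\<Prod>e\<in>S. h e) \<noteq> 0" "h e \<noteq> 0" using insert by (auto simp: prod_zero_iff)
  have "order r (h e) = (if poly (h e) r = 0 then 1 else 0)"
  proof (cases "poly (h e) r = 0")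
    case True
    have "order r (h e) \<le> 1" using order_degree[OF nz(2), of r] he by simp
    moreover have "order r (h e) \<noteq> 0" using True nz(2) by (simp add: order_root)
    ultimately show ?thesis using True by simp
  next
    case False
    then show ?thesis by (simp add: order_0I)
  qed
  moreover have "{e' \<in> insert e S. poly (h e') r = 0}
      = (if poly (h e) r = 0 then insert e {e' \<in> S. poly (h e') r = 0} else {e' \<in> S. poly (h e') r = 0})"
    by auto
  moreover have "order r (\<Prod>e\<in>insert e S. h e) = order r (h e) + order r (\<Prod>e\<in>S. h e)"
    using insert.hyps nz by (simp add: order_mult)
  moreover have "order r (\<Prod>e\<in>S. h e) = card {e' \<in> S. poly (h e') r = 0}"
    using insert.IH insert.prems by blast
  ultimately show ?case using insert.hyps by simp
qed

text \<open>At the root of a factor occurring in exactly one of \<open>S\<close> and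
  \<open>T\<close>, one side has odd and the other even order. The hypothesis \<open>dist\<close>
  says that distinct factors have distinct roots.\<close>

lemma linear_prod_not_square_multiple:
  fixes P Q :: "complex poly"
  assumes "finite E" "S \<subseteq> E" "T \<subseteq> E" "S \<noteq> T" "P \<noteq> 0" "Q \<noteq> 0"
    and \<beta>: "\<And>e. e \<in> E \<Longrightarrow> \<beta> e \<noteq> 0"
    and dist: "\<And>e e'. e \<in> E \<Longrightarrow> e' \<in> E \<Longrightarrow> e \<noteq> e' \<Longrightarrow> \<alpha> e * \<beta> e' \<noteq> \<alpha> e' * \<beta> e"
  shows "P\<^sup>2 * (\<Prod>e\<in>S. [:\<alpha> e, \<beta> e:]) \<noteq> smult c (Q\<^sup>2 * (\<Prod>e\<in>T. [:\<alpha> e, \<beta> e:]))"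
proof
  let ?h = "\<lambda>e. [:\<alpha> e, \<beta> e:]"
  assume eq: "P\<^sup>2 * prod ?h S = smult c (Q\<^sup>2 * prod ?h T)"
  have fin: "finite S" "finite T" using assms(1-3) finite_subset by blast+
  have nz: "prod ?h S \<noteq> 0" "prod ?h T \<noteq> 0"
    using fin \<beta> assms(2,3) by (auto simp: prod_zero_iff)
  have "c \<noteq> 0" using eq nz assms(5) by auto
  then have ord: "2 * order r P + order r (prod ?h S) = 2 * order r Q + order r (prod ?h T)" for r
    using arg_cong[OF eq, of "order r"] order_square_times[OF assms(5) nz(1), of r]
      order_square_times[OF assms(6) nz(2), of r] by (simp add: order_smult)
  obtain e where e: "e \<in> E" "(e \<in> S) \<noteq> (e \<in> T)" using assms(2-4) by blast
  define r where "r = - \<alpha> e / \<beta> e"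
  have root: "poly (?h e') r = 0 \<longleftrightarrow> e' = e" if "e' \<in> E" for e'
  proof (cases "e' = e")
    case True
    then show ?thesis using \<beta>[OF e(1)] by (simp add: r_def)
  next
    case False
    then show ?thesis using \<beta>[OF e(1)] dist[OF e(1) that] by (simp add: r_def field_simps)
  qed
  have o: "order r (prod ?h U) = (if e \<in> U then 1 else 0)" if "U \<subseteq> E" for U
  proof -
    have "{e' \<in> U. poly (?h e') r = 0} = (if e \<in> U then {e} else {})"
      using root that by (auto split: if_splits)
    then show ?thesis
      using order_linear_prod[of U ?h \<alpha> \<beta> r] finite_subset[OF that assms(1)] \<beta> that
      by (auto simp: subset_iff)
  qed
  have "2 * order r P + (if e \<in> S then 1 else 0) = 2 * order r Q + (if e \<in> T then 1 else 0)"
    using ord[of r] o assms(2,3) by simp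
  then show False using e(2) by (auto split: if_splits) presburger+
qed

section \<open>Multiquadratic covers\<close>

text \<open>Monomials are sorted by the set \<open>S\<close> of variables in \<open>E\<close> with
  odd exponent; what remains is a polynomial in the squares.\<close>

lemma parity_decomposition:
  assumes "finite E" "poly_deg I m f"
  shows "\<exists>F. (\<forall>S. poly_deg I m (F S)) \<and>
    (\<forall>x. f x = (\<Sum>S\<in>Pow E. F S (\<lambda>v. if v \<in> E then (x v)\<^sup>2 else x v) * (\<Prod>e\<in>S. x e)))"
  using assms(2)
proof (induction rule: poly_deg.induct)
  case (const m c)
  have "(\<Sum>S\<in>Pow E. (if S = {} then c else 0) * (\<Prod>e\<in>S. x e)) = c" for x :: "'a \<Rightarrow> complex"
    using assms(1) by (subst sum.remove[of _ "{}"]) (auto intro!: sum.neutral)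
  then show ?case
    by (intro exI[of _ "\<lambda>S x. if S = {} then c else 0"]) (auto intro: poly_deg.const)
next
  case (add m f g)
  obtain F where F: "\<And>S. poly_deg I m (F S)"
    "\<And>x. f x = (\<Sum>S\<in>Pow E. F S (\<lambda>v. if v \<in> E then (x v)\<^sup>2 else x v) * (\<Prod>e\<in>S. x e))"
    using add.IH(1) by blast
  obtain G where G: "\<And>S. poly_deg I m (G S)"
    "\<And>x. g x = (\<Sum>S\<in>Pow E. G S (\<lambda>v. if v \<in> E then (x v)\<^sup>2 else x v) * (\<Prod>e\<in>S. x e))"
    using add.IH(2) by blast
  show ?case
    by (intro exI[of _ "\<lambda>S x. F S x + G S x"])
      (auto simp: F(2) G(2) sum.distrib distrib_right intro: poly_deg.add F(1) G(1))
next
  case (var_mult i m f)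
  obtain F where F: "\<And>S. poly_deg I m (F S)"
    "\<And>x. f x = (\<Sum>S\<in>Pow E. F S (\<lambda>v. if v \<in> E then (x v)\<^sup>2 else x v) * (\<Prod>e\<in>S. x e))"
    using var_mult.IH by blast
  show ?case
  proof (cases "i \<in> E")
    case False
    then show ?thesis
      by (intro exI[of _ "\<lambda>S x. x i * F S x"])
        (auto simp: F(2) sum_distrib_left mult.assoc intro: poly_deg.var_mult var_mult F(1))
  next
    case True
    \<comment> \<open>Multiplication by \<open>x i\<close> toggles the membership of
      \<open>i\<close> in \<open>S\<close>. If \<open>i\<close> was in \<open>S\<close>, the two
      copies of \<open>x i\<close> merge into a square, which is the factor \<open>x i\<close> in
      \<open>G\<close>.\<close>
    define \<tau> where "\<tau> = (\<lambda>S. if i \<in> S then S - {i} else insert i S)"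
    define G where "G = (\<lambda>S x. if i \<in> S then F (S - {i}) x else x i * F (insert i S) x)"
    have deg: "poly_deg I (Suc m) (G S)" for S
      unfolding G_def using poly_deg.var_mult[OF var_mult(1) F(1)] poly_deg_mono[OF F(1)]
      by (cases "i \<in> S") auto
    have bij: "bij_betw \<tau> (Pow E) (Pow E)"
      by (rule bij_betw_byWitness[where f' = \<tau>]) (use True in \<open>auto simp: \<tau>_def\<close>)
    have "x i * f x = (\<Sum>S\<in>Pow E. G S (\<lambda>v. if v \<in> E then (x v)\<^sup>2 else x v) * (\<Prod>e\<in>S. x e))" for x
    proof -
      let ?y = "\<lambda>v. if v \<in> E then (x v)\<^sup>2 else x v"
      have "x i * (F S ?y * (\<Prod>e\<in>S. x e)) = G (\<tau> S) ?y * (\<Prod>e\<in>\<tau> S. x e)" if "S \<in> Pow E" for S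
      proof -
        have fin: "finite S" using that assms(1) finite_subset by auto
        show ?thesis
        proof (cases "i \<in> S")
          case True
          then have "(\<Prod>e\<in>S. x e) = x i * (\<Prod>e\<in>S - {i}. x e)" using fin by (simp add: prod.remove)
          then show ?thesis using True \<open>i \<in> E\<close>
            by (simp add: \<tau>_def G_def insert_absorb power2_eq_square mult_ac)
        next
          case False
          then show ?thesis using fin by (simp add: \<tau>_def G_def mult_ac)
        qed
      qed
      then have "x i * f x = (\<Sum>S\<in>Pow E. G (\<tau> S) ?y * (\<Prod>e\<in>\<tau> S. x e))"
        unfolding F(2) sum_distrib_left by (intro sum.cong) auto
      also have "\<dots> = (\<Sum>S\<in>Pow E. G S ?y * (\<Prod>e\<in>S. x e))"
        by (rule sum.reindex_bij_betw[OF bij])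
      finally show ?thesis .
    qed
    then show ?thesis using deg by (intro exI[of _ G]) blast
  qed
qed

text \<open>The parameter \<open>p\<close> is projected away: a point only records values of
  \<open>Y p\<close> and independent choices of square roots on \<open>E\<close>.\<close>

definition cover :: "'v set \<Rightarrow> 'v set \<Rightarrow> 'w set \<Rightarrow> (('w \<Rightarrow> complex) \<Rightarrow> 'v \<Rightarrow> complex) \<Rightarrow> ('v \<Rightarrow> complex) set"
  where "cover I E J Y = {x \<in> aff I. \<exists>p\<in>aff J. \<forall>v\<in>I. if v \<in> E then (x v)\<^sup>2 = Y p v else x v = Y p v}"

text \<open>Along the direction \<open>w\<close> the functions under the square roots are linear with distinct roots,
  so the \<open>2^|E|\<close> products of their square roots are linearly independent over the polynomials.\<close>

lemma prime_on_cover: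
  assumes I: "finite I" "E \<subseteq> I"
    and Y: "\<And>v. v \<in> I \<Longrightarrow> (\<lambda>p. Y p v) \<in> poly_fun UNIV" and w: "w \<in> aff J"
    and \<beta>: "\<And>e. e \<in> E \<Longrightarrow> \<beta> e \<in> poly_fun UNIV"
    and line: "\<And>e p t. e \<in> E \<Longrightarrow> Y (\<lambda>v. p v + t * w v) e = Y p e + t * \<beta> e p"
    and p0: "p0 \<in> aff J" "\<And>e. e \<in> E \<Longrightarrow> Y p0 e \<noteq> 0" "\<And>e. e \<in> E \<Longrightarrow> \<beta> e p0 \<noteq> 0"
      "\<And>e e'. e \<in> E \<Longrightarrow> e' \<in> E \<Longrightarrow> e \<noteq> e' \<Longrightarrow> Y p0 e * \<beta> e' p0 \<noteq> Y p0 e' * \<beta> e p0"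
  shows "prime_on I (cover I E J Y)"
  unfolding prime_on_def
proof (intro conjI ballI impI)
  have zero: "(\<lambda>_. 0) \<in> aff J" by (simp add: aff_def)
  let ?x = "\<lambda>v. if v \<in> E then csqrt (Y (\<lambda>_. 0) v) else if v \<in> I then Y (\<lambda>_. 0) v else 0"
  have "?x \<in> cover I E J Y" unfolding cover_def using zero I(2) by (auto simp: aff_def intro!: bexI[OF _ zero])
  then show "cover I E J Y \<noteq> {}" by blast
next
  fix f g assume fg: "f \<in> poly_fun I" "g \<in> poly_fun I" "\<forall>x\<in>cover I E J Y. f x * g x = 0"
  have E: "finite E" using I finite_subset by blast
  define sq where "sq = (\<lambda>(x :: 'a \<Rightarrow> complex) v. if v \<in> E then (x v)\<^sup>2 else x v)"
  have decomp: "\<exists>F. (\<forall>S. F S \<in> poly_fun I) \<and> (\<forall>x. f x = (\<Sum>S\<in>Pow E. F S (sq x) * (\<Prod>e\<in>S. x e)))"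
    if "f \<in> poly_fun I" for f
    using poly_fun_imp_poly_deg[OF that] parity_decomposition[OF E, of I _ f] poly_deg_imp_poly_fun
    unfolding sq_def by blast
  obtain F where F: "\<And>S. F S \<in> poly_fun I" "\<And>x. f x = (\<Sum>S\<in>Pow E. F S (sq x) * (\<Prod>e\<in>S. x e))"
    using decomp[OF fg(1)] by blast
  obtain G where G: "\<And>S. G S \<in> poly_fun I" "\<And>x. g x = (\<Sum>S\<in>Pow E. G S (sq x) * (\<Prod>e\<in>S. x e))"
    using decomp[OF fg(2)] by blast
  have FY: "(\<lambda>p. F (Y p)) \<in> poly_fun UNIV" if "F \<in> poly_fun I" for F
    by (rule poly_fun_compose[OF that Y])
  \<comment> \<open>A function that is nonzero somewhere on the cover has a component that is
    nonzero somewhere on the base.\<close>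
  have coeff: "\<exists>S\<in>Pow E. \<exists>p\<in>aff J. F S (Y p) \<noteq> 0"
    if F: "\<And>S. F S \<in> poly_fun I" "\<And>x. f x = (\<Sum>S\<in>Pow E. F S (sq x) * (\<Prod>e\<in>S. x e))"
      and x: "x \<in> cover I E J Y" "f x \<noteq> 0" for F f x
  proof -
    obtain p where p: "p \<in> aff J" "\<And>v. v \<in> I \<Longrightarrow> sq x v = Y p v"
      using x(1) unfolding cover_def sq_def by force
    obtain S where S: "S \<in> Pow E" "F S (sq x) \<noteq> 0"
      using x(2) unfolding F(2) by (auto elim: sum.not_neutral_contains_not_neutral)
    have "F S (sq x) = F S (Y p)" by (rule poly_fun_cong[OF F(1) p(2)])
    then show ?thesis using p(1) S by auto
  qed
  show "(\<forall>x\<in>cover I E J Y. f x = 0) \<or> (\<forall>x\<in>cover I E J Y. g x = 0)"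
  proof (rule ccontr)
    assume "\<not> ?thesis"
    then obtain x0 x1 where x: "x0 \<in> cover I E J Y" "f x0 \<noteq> 0" "x1 \<in> cover I E J Y" "g x1 \<noteq> 0" by blast
    obtain S T q0 q1 where ST: "S \<in> Pow E" "q0 \<in> aff J" "F S (Y q0) \<noteq> 0"
      "T \<in> Pow E" "q1 \<in> aff J" "G T (Y q1) \<noteq> 0"
      using coeff[OF F x(1,2)] coeff[OF G x(3,4)] by blast
    \<comment> \<open>These finitely many polynomials encode all that is asked of the base point:
      the two chosen components survive, and the linear functions on the line through it have
      nonzero slopes and distinct nonzero roots.\<close>
    define NZ where "NZ = {\<lambda>p. F S (Y p), \<lambda>p. G T (Y p)} \<union> (\<lambda>e p. Y p e) ` E \<union> \<beta> ` E
      \<union> (\<lambda>(e, e') p. Y p e * \<beta> e' p - Y p e' * \<beta> e p) ` {(e, e'). e \<in> E \<and> e' \<in> E \<and> e \<noteq> e'}"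
    have "finite {(e, e'). e \<in> E \<and> e' \<in> E \<and> e \<noteq> e'}"
      by (rule finite_subset[of _ "E \<times> E"]) (use E in auto)
    then have "finite NZ" using E unfolding NZ_def by blast
    moreover have "NZ \<subseteq> poly_fun UNIV"
      unfolding NZ_def using FY[OF F(1)] FY[OF G(1)] Y \<beta> I(2)
      by (auto intro!: poly_fun_diff poly_fun.mult)
    moreover have "\<exists>y\<in>aff J. k y \<noteq> 0" if "k \<in> NZ" for k
      using that ST p0(2-) unfolding NZ_def by (elim UnE) (auto intro: bexI[OF _ p0(1)])
    ultimately obtain p where p: "p \<in> aff J" "\<And>k. k \<in> NZ \<Longrightarrow> k p \<noteq> 0"
      using poly_fun_nonzero_finite[of NZ UNIV J] by blast
    have pF: "F S (Y p) \<noteq> 0" "G T (Y p) \<noteq> 0" and pE: "\<And>e. e \<in> E \<Longrightarrow> Y p e \<noteq> 0 \<and> \<beta> e p \<noteq> 0"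
      using p(2) unfolding NZ_def by auto
    have pW: "Y p e * \<beta> e' p \<noteq> Y p e' * \<beta> e p" if "e \<in> E" "e' \<in> E" "e \<noteq> e'" for e e'
    proof -
      have "(\<lambda>p. Y p e * \<beta> e' p - Y p e' * \<beta> e p) \<in> NZ" unfolding NZ_def using that by auto
      then show ?thesis using p(2) by fastforce
    qed
    \<comment> \<open>At most the distance from 0 to the root of any
      \<open>Y p e + t * \<beta> e p\<close>; the \<open>1\<close> keeps the minimum defined for
      empty \<open>E\<close>.\<close>
    define r where "r = Min (insert 1 ((\<lambda>e. norm (Y p e / \<beta> e p)) ` E))"
    have r: "r > 0" unfolding r_def using E pE by (auto simp: Min_gr_iff)
    have small: "1 + \<beta> e p / Y p e * t \<notin> \<real>\<^sub>\<le>\<^sub>0" if "e \<in> E" "t \<in> ball 0 r" for e t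
    proof -
      have "r \<le> norm (Y p e / \<beta> e p)" unfolding r_def using E that(1) by (intro Min_le) auto
      then have "norm t < norm (Y p e / \<beta> e p)" using that(2) by simp
      then have "norm (\<beta> e p / Y p e * t) < 1"
        using pE[OF that(1)] by (simp add: norm_mult norm_divide field_simps)
      then have "Re (\<beta> e p / Y p e * t) > -1" using abs_Re_le_cmod[of "\<beta> e p / Y p e * t"] by linarith
      then show ?thesis by (auto simp: complex_nonpos_Reals_iff)
    qed
    define B where "B = ball (0::complex) r"
    have B: "open B" "B \<noteq> {}" "connected B" using r by (auto simp: B_def)
    \<comment> \<open>Splitting off \<open>Y p e\<close> keeps the argument of the second root in
      the right half plane, away from the branch cut.\<close>
    define l where "l = (\<lambda>e t. csqrt (Y p e) * csqrt (1 + \<beta> e p / Y p e * t))"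
    have lhol: "l e holomorphic_on B" if "e \<in> E" for e
      unfolding l_def using small[OF that] by (auto intro!: holomorphic_intros simp: B_def)
    have lsq: "(l e t)\<^sup>2 = Y p e + t * \<beta> e p" if "e \<in> E" for e t
      using pE[OF that] by (simp add: l_def power_mult_distrib field_simps)
    let ?q = "\<lambda>t v. p v + t * w v"
    define \<phi> where "\<phi> = (\<lambda>t v. if v \<in> E then l v t else if v \<in> I then Y (?q t) v else 0)"
    have \<phi>: "\<phi> t \<in> cover I E J Y" for t
      unfolding cover_def using p(1) w lsq line I(2)
      by (auto simp: aff_def \<phi>_def intro!: exI[of _ "?q t"] bexI[of _ "?q t"])
    have val: "\<exists>Q. (\<forall>t. f (\<phi> t) = (\<Sum>S\<in>Pow E. poly (Q S) t * (\<Prod>e\<in>S. l e t))) \<and>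
        (\<forall>S. poly (Q S) 0 = F S (Y p))"
      if F: "\<And>S. F S \<in> poly_fun I" "\<And>x. f x = (\<Sum>S\<in>Pow E. F S (sq x) * (\<Prod>e\<in>S. x e))" for F f
    proof -
      obtain Q where Q: "\<And>S t. F S (Y (?q t)) = poly (Q S) t"
        using poly_fun_line[OF FY[OF F(1)], of _ p w] by metis
      have "F S (sq (\<phi> t)) = F S (Y (?q t))" for S t
        by (rule poly_fun_cong[OF F(1)]) (auto simp: sq_def \<phi>_def lsq line)
      moreover have "(\<Prod>e\<in>S. \<phi> t e) = (\<Prod>e\<in>S. l e t)" if "S \<in> Pow E" for S t
        using that by (intro prod.cong) (auto simp: \<phi>_def)
      ultimately have "f (\<phi> t) = (\<Sum>S\<in>Pow E. poly (Q S) t * (\<Prod>e\<in>S. l e t))" for t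
        unfolding F(2) by (intro sum.cong) (auto simp: Q)
      then show ?thesis using Q[of _ 0] by (intro exI[of _ Q]) simp
    qed
    obtain P where P: "\<And>t. f (\<phi> t) = (\<Sum>S\<in>Pow E. poly (P S) t * (\<Prod>e\<in>S. l e t))"
      "\<And>S. poly (P S) 0 = F S (Y p)" using val[OF F] by blast
    obtain Q where Q: "\<And>t. g (\<phi> t) = (\<Sum>S\<in>Pow E. poly (Q S) t * (\<Prod>e\<in>S. l e t))"
      "\<And>S. poly (Q S) 0 = G S (Y p)" using val[OF G] by blast
    have hol: "(\<lambda>t. \<Prod>e\<in>S. l e t) holomorphic_on B" if "S \<in> Pow E" for S
      using that lhol by (intro holomorphic_intros) auto
    have indep: "\<forall>S\<in>Pow E. Q S = 0"
      if "\<And>t. t \<in> B \<Longrightarrow> (\<Sum>S\<in>Pow E. poly (Q S) t * (\<Prod>e\<in>S. l e t)) = 0" for Q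
    proof (rule sqrt_independent[OF _ B(1,2) hol _ _ _ that,
        where h = "\<lambda>S. \<Prod>e\<in>S. [:Y p e, \<beta> e p:]"])
      show "(\<Prod>e\<in>S. l e t)\<^sup>2 = poly (\<Prod>e\<in>S. [:Y p e, \<beta> e p:]) t" if "S \<in> Pow E" for S t
        using that lsq by (auto simp: poly_prod prod_power_distrib intro!: prod.cong)
      show "(\<Prod>e\<in>S. [:Y p e, \<beta> e p:]) \<noteq> 0" if "S \<in> Pow E" for S
        using that E pE finite_subset[of S E] by (auto simp: prod_zero_iff)
      show "P\<^sup>2 * (\<Prod>e\<in>S. [:Y p e, \<beta> e p:]) \<noteq> smult c (Q\<^sup>2 * (\<Prod>e\<in>T. [:Y p e, \<beta> e p:]))"
        if "S \<in> Pow E" "T \<in> Pow E" "S \<noteq> T" "P \<noteq> 0" "Q \<noteq> 0" for S T P Q c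
        using linear_prod_not_square_multiple[OF E, of S T P Q "\<lambda>e. \<beta> e p" "\<lambda>e. Y p e" c] that pE pW
        by auto
    qed (use E in auto)
    \<comment> \<open>If not, \<open>g\<close> vanishes along the curve on an open set, hence on all
      of \<open>B\<close>, and independence kills \<open>Q T\<close>, whose value at 0 was chosen
      nonzero.\<close>
    have "f (\<phi> t) = 0" if "t \<in> B" for t
    proof (rule ccontr)
      assume ft: "f (\<phi> t) \<noteq> 0"
      have fhol: "(\<lambda>t. f (\<phi> t)) holomorphic_on B" and ghol: "(\<lambda>t. g (\<phi> t)) holomorphic_on B"
        unfolding P(1) Q(1) by (intro holomorphic_on_sum holomorphic_on_mult hol holomorphic_intros; simp)+
      define U where "U = {t \<in> B. f (\<phi> t) \<noteq> 0}"
      have "open (B \<inter> (\<lambda>t. f (\<phi> t)) -` (- {0}))"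
        using holomorphic_on_imp_continuous_on[OF fhol] B(1)
        by (intro continuous_open_preimage) auto
      moreover have "B \<inter> (\<lambda>t. f (\<phi> t)) -` (- {0}) = U" by (auto simp: U_def)
      ultimately have U: "open U" "U \<noteq> {}" "U \<subseteq> B" using ft that by (auto simp: U_def)
      have "g (\<phi> z) = 0" if "z \<in> U" for z using fg(3) \<phi>[of z] that by (auto simp: U_def)
      then have "g (\<phi> z) = 0" if "z \<in> B" for z
        using analytic_continuation_open[OF U(1) B(1) U(2) B(3) U(3) ghol, of "\<lambda>_. 0"] that by simp
      then have "Q T = 0" using indep[of Q] ST(4) by (simp add: Q(1))
      then show False using Q(2)[of T] pF by simp
    qed
    then have "P S = 0" using indep[of P] ST(1) by (simp add: P(1))
    then show False using P(2)[of S] pF by simp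
  qed
qed

section \<open>Schur complements of bilinear forms\<close>

text \<open>The Schur complement scaled by the pivot, so that no division occurs and the entries stay
  polynomial.\<close>

definition schur :: "'a \<Rightarrow> ('a \<Rightarrow> 'a \<Rightarrow> complex) \<Rightarrow> 'a \<Rightarrow> 'a \<Rightarrow> complex" where
  "schur v G = (\<lambda>x y. G v v * G x y - G x v * G v y)"

text \<open>Nonzero exactly when elimination along the list never meets a zero pivot; as a
  polynomial in the entries this is a generic condition.\<close>

primrec pivots :: "'a list \<Rightarrow> ('a \<Rightarrow> 'a \<Rightarrow> complex) \<Rightarrow> complex" where
  "pivots [] G = 1"
| "pivots (v # vs) G = G v v * pivots vs (schur v G)"

text \<open>An arbitrary finite index set lets a single term be dropped without renumbering.\<close>

definition rank_le :: "nat \<Rightarrow> ('a \<Rightarrow> 'a \<Rightarrow> complex) \<Rightarrow> bool" where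
  "rank_le d G \<longleftrightarrow> (\<exists>(A :: nat set) p r. finite A \<and> card A \<le> d \<and>
     (\<forall>x y. G x y = (\<Sum>k\<in>A. p k x * r k y)))"

text \<open>The complement vanishes when its second argument is \<open>v\<close>, a linear relation
  that eliminates one left factor. With a zero pivot the complement is a product of two functions;
  for \<open>d = 0\<close> it is zero, because then \<open>G\<close> is a single product vanishing
  at \<open>v\<close>, \<open>v\<close>.\<close>

lemma rank_le_schur:
  assumes "rank_le (Suc d) G"
  shows "rank_le d (schur v G)"
proof -
  obtain A :: "nat set" and p r where A: "finite A" "card A \<le> Suc d"
    and G: "\<And>x y. G x y = (\<Sum>k\<in>A. p k x * r k y)"
    using assms unfolding rank_le_def by blast
  show ?thesis
  proof (cases "G v v = 0")
    case True
    show ?thesis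
    proof (cases "d = 0")
      case False
      then show ?thesis unfolding rank_le_def using True
        by (intro exI[of _ "{0}"] exI[of _ "\<lambda>_ x. - G x v"] exI[of _ "\<lambda>_ y. G v y"])
          (auto simp: schur_def)
    next
      case d: True
      then consider "A = {}" | a where "A = {a}"
        using A by (metis card_0_eq card_1_singletonE le_Suc_eq One_nat_def le_zero_eq)
      then have "schur v G x y = 0" for x y
      proof cases
        case 2
        then have "p a v = 0 \<or> r a v = 0" using True by (simp add: G)
        then show ?thesis by (auto simp: schur_def G 2)
      qed (simp add: schur_def G)
      then show ?thesis unfolding rank_le_def by (intro exI[of _ "{}"]) simp
    qed
  next
    case False
    then obtain m where m: "m \<in> A" "r m v \<noteq> 0"
      unfolding G[of v v] by (auto elim: sum.not_neutral_contains_not_neutral)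
    define P where "P = (\<lambda>k x. G v v * p k x - G x v * p k v)"
    have PG: "(\<Sum>k\<in>A. P k x * r k y) = schur v G x y" for x y
      by (simp add: P_def schur_def left_diff_distrib sum_subtractf mult.assoc
          flip: sum_distrib_left G)
    \<comment> \<open>This is \<open>schur v G x v = 0\<close>, solved for the term
      \<open>m\<close>.\<close>
    have "P m x * r m v = - (\<Sum>k\<in>A - {m}. P k x * r k v)" for x
      using PG[of x v] A(1) m(1) by (simp add: schur_def sum.remove add_eq_0_iff2)
    then have Pm: "P m x = - (\<Sum>k\<in>A - {m}. P k x * r k v) / r m v" for x
      using nonzero_eq_divide_eq[OF m(2)] by blast
    have "schur v G x y = (\<Sum>k\<in>A - {m}. P k x * (r k y - r k v / r m v * r m y))" for x y
    proof -
      have "schur v G x y = P m x * r m y + (\<Sum>k\<in>A - {m}. P k x * r k y)"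
        using PG[of x y] A(1) m(1) by (simp add: sum.remove)
      also have "P m x * r m y = - (\<Sum>k\<in>A - {m}. P k x * (r k v / r m v * r m y))"
        unfolding Pm by (simp add: sum_divide_distrib sum_distrib_right sum_distrib_left mult_ac)
      finally show ?thesis by (simp add: right_diff_distrib sum_subtractf)
    qed
    moreover have "card (A - {m}) \<le> d" using A m(1) by simp
    ultimately show ?thesis unfolding rank_le_def
      by (intro exI[of _ "A - {m}"] exI[of _ P] exI[of _ "\<lambda>k y. r k y - r k v / r m v * r m y"])
        (use A(1) in auto)
  qed
qed

lemma rank_le_fold_schur: "rank_le (length vs) G \<Longrightarrow> fold schur vs G x y = 0"
proof (induction vs arbitrary: G)
  case Nil
  then show ?case by (auto simp: rank_le_def)
qed (auto dest: rank_le_schur)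

lemma schur_sym: "(\<And>x y. G x y = G y x) \<Longrightarrow> schur v G x y = schur v G y x"
  unfolding schur_def by (metis mult.commute)

text \<open>Completing the square with respect to \<open>v\<close>; complex square roots avoid any
  sign condition.\<close>

lemma square_expansion:
  assumes "G v v \<noteq> 0" "\<And>x y. G x y = G y x"
    and "\<And>x y. schur v G x y = (\<Sum>k<d. q k x * q k y)"
  defines "a \<equiv> csqrt (G v v)"
  defines "q' \<equiv> \<lambda>k x. case k of 0 \<Rightarrow> G x v / a | Suc k \<Rightarrow> q k x / a"
  shows "G x y = (\<Sum>k<Suc d. q' k x * q' k y)"
proof -
  have a: "a * a = G v v" "a \<noteq> 0" using assms(1) by (auto simp: a_def simp flip: power2_eq_square)
  have "(\<Sum>k<Suc d. q' k x * q' k y) = (G x v * G y v + (\<Sum>k<d. q k x * q k y)) / (a * a)"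
    by (simp add: sum.lessThan_Suc_shift q'_def sum_divide_distrib add_divide_distrib
        del: sum.lessThan_Suc)
  also have "\<dots> = G x y"
    using assms(1) unfolding a assms(3)[symmetric] schur_def assms(2)[of y v] by simp
  finally show ?thesis ..
qed

text \<open>By polarization a nonzero form has some \<open>v\<close> with \<open>G v v\<close>
  nonzero, and the square at \<open>v\<close> can be split off. Such a \<open>v\<close> need not be
  a basis vector, hence the hypothesis over all lists of vectors.\<close>

lemma sum_of_squares:
  fixes G :: "('a \<Rightarrow> complex) \<Rightarrow> ('a \<Rightarrow> complex) \<Rightarrow> complex"
  assumes "\<And>x y. G x y = G y x" "\<And>x y z. G (\<lambda>i. x i + y i) z = G x z + G y z"
    and "\<And>vs x y. length vs = d \<Longrightarrow> fold schur vs G x y = 0"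
  shows "\<exists>q. \<forall>x y. G x y = (\<Sum>k<d. q k x * q k y)"
  using assms
proof (induction d arbitrary: G)
  case 0
  then show ?case using 0(3)[of "[]"] by simp
next
  case (Suc d)
  show ?case
  proof (cases "\<forall>v. G v v = 0")
    case True
    have "G x y = 0" for x y
    proof -
      have "G (\<lambda>i. x i + y i) (\<lambda>i. x i + y i) = G x x + G y y + 2 * G x y"
        using Suc.prems(2)[of x y "\<lambda>i. x i + y i"] Suc.prems(2)[of x y x] Suc.prems(2)[of x y y]
          Suc.prems(1)[of x "\<lambda>i. x i + y i"] Suc.prems(1)[of y "\<lambda>i. x i + y i"] Suc.prems(1)[of x y]
        by simp
      then show ?thesis using True by simp
    qed
    then show ?thesis by (intro exI[of _ "\<lambda>_ _. 0"]) simp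
  next
    case False
    then obtain v where v: "G v v \<noteq> 0" by blast
    have "\<exists>q. \<forall>x y. schur v G x y = (\<Sum>k<d. q k x * q k y)"
    proof (rule Suc.IH)
      show "schur v G x y = schur v G y x" for x y by (rule schur_sym[OF Suc.prems(1)])
      show "schur v G (\<lambda>i. x i + y i) z = schur v G x z + schur v G y z" for x y z
        by (simp add: schur_def Suc.prems(2) algebra_simps)
      show "fold schur vs (schur v G) x y = 0" if "length vs = d" for vs x y
        using Suc.prems(3)[of "v # vs"] that by simp
    qed
    then obtain q where "\<And>x y. schur v G x y = (\<Sum>k<d. q k x * q k y)" by blast
    from square_expansion[OF v Suc.prems(1) this] show ?thesis
      by (intro exI[of _ "\<lambda>k x. case k of 0 \<Rightarrow> G x v / csqrt (G v v) | Suc k \<Rightarrow> q k x / csqrt (G v v)"])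
        blast
  qed
qed

text \<open>The factors are triangular along \<open>vs\<close> because a pivot vector lies in the
  radical of its own complement. The third clause carries this through the induction and later puts
  point 1 at the origin.\<close>

lemma cholesky:
  assumes "\<And>x y. G x y = G y x" "pivots vs G \<noteq> 0" "\<And>x y. fold schur vs G x y = 0"
  shows "\<exists>q. (\<forall>x y. G x y = (\<Sum>k<length vs. q k x * q k y)) \<and>
    (\<forall>k<length vs. \<forall>b<k. q k (vs ! b) = 0) \<and>
    (\<forall>k<length vs. \<forall>z. (\<forall>y. G z y = 0) \<longrightarrow> q k z = 0)"
  using assms
proof (induction vs arbitrary: G)
  case (Cons v vs)
  have v: "G v v \<noteq> 0" using Cons.prems(2) by simp
  have "pivots vs (schur v G) \<noteq> 0" "\<And>x y. fold schur vs (schur v G) x y = 0"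
    using Cons.prems(2,3) by auto
  from Cons.IH[OF schur_sym[OF Cons.prems(1)] this] obtain q
    where Q: "(\<forall>x y. schur v G x y = (\<Sum>k<length vs. q k x * q k y)) \<and>
      (\<forall>k<length vs. \<forall>b<k. q k (vs ! b) = 0) \<and>
      (\<forall>k<length vs. \<forall>z. (\<forall>y. schur v G z y = 0) \<longrightarrow> q k z = 0)" ..
  note q = conjunct1[OF Q, rule_format] conjunct1[OF conjunct2[OF Q], rule_format]
    conjunct2[OF conjunct2[OF Q], rule_format]
  define q' where "q' = (\<lambda>k x. case k of 0 \<Rightarrow> G x v / csqrt (G v v) | Suc k \<Rightarrow> q k x / csqrt (G v v))"
  have "G x y = (\<Sum>k<length (v # vs). q' k x * q' k y)" for x y
    using square_expansion[OF v Cons.prems(1) q(1)] unfolding q'_def by simp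
  moreover have "q' k ((v # vs) ! b) = 0" if kb: "k < length (v # vs)" "b < k" for k b
  proof -
    obtain k' where k': "k = Suc k'" using kb(2) by (cases k) auto
    have "q k' v = 0" using q(3)[of k' v] k' kb(1) by (simp add: schur_def)
    then show ?thesis using k' kb q(2)[of k'] by (cases b) (auto simp: q'_def)
  qed
  moreover have "q' k z = 0" if "k < length (v # vs)" "\<forall>y. G z y = 0" for k z
    using that q(3)[of "k - 1" z] by (cases k) (auto simp: q'_def schur_def)
  ultimately show ?case by blast
qed simp

lemma poly_fun_schur:
  assumes "\<And>v w. (\<lambda>x. G x v w) \<in> poly_fun I"
  shows "(\<lambda>x. schur u (G x) v w) \<in> poly_fun I"
  unfolding schur_def by (intro poly_fun_diff poly_fun.mult assms)

lemma poly_fun_fold_schur: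
  assumes "\<And>v w. (\<lambda>x. G x v w) \<in> poly_fun I"
  shows "(\<lambda>x. fold schur vs (G x) v w) \<in> poly_fun I"
  using assms
proof (induction vs arbitrary: G)
  case (Cons u vs)
  have "(\<lambda>x. schur u (G x) v w) \<in> poly_fun I" for v w
    by (rule poly_fun_schur) (rule Cons.prems)
  then show ?case using Cons.IH[of "\<lambda>x. schur u (G x)"] by simp
qed simp

lemma poly_fun_pivots:
  assumes "\<And>v w. (\<lambda>x. G x v w) \<in> poly_fun I"
  shows "(\<lambda>x. pivots vs (G x)) \<in> poly_fun I"
  using assms
proof (induction vs arbitrary: G)
  case (Cons u vs)
  have "(\<lambda>x. schur u (G x) v w) \<in> poly_fun I" for v w
    by (rule poly_fun_schur) (rule Cons.prems)
  then show ?case using Cons.IH[of "\<lambda>x. schur u (G x)"] Cons.prems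
    by (auto intro: poly_fun.mult)
qed (simp add: poly_fun.const)

lemma fold_schur_cong:
  assumes "\<And>v w. v \<in> V \<Longrightarrow> w \<in> V \<Longrightarrow> G v w = G' v w" "set vs \<subseteq> V" "v \<in> V" "w \<in> V"
  shows "fold schur vs G v w = fold schur vs G' v w"
  using assms
proof (induction vs arbitrary: G G')
  case (Cons u vs)
  have "fold schur vs (schur u G) v w = fold schur vs (schur u G') v w"
    by (rule Cons.IH) (use Cons.prems in \<open>auto simp: schur_def\<close>)
  then show ?case by simp
qed simp

section \<open>Elimination for standard diagonal forms\<close>

definition unit_vec :: "nat \<Rightarrow> nat \<Rightarrow> complex" where
  "unit_vec a = (\<lambda>i. if i = a then 1 else 0)"

definition diag_form :: "nat set \<Rightarrow> (nat \<Rightarrow> complex) \<Rightarrow> (nat \<Rightarrow> complex) \<Rightarrow> complex" where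
  "diag_form A = (\<lambda>x y. \<Sum>k\<in>A. x k * y k)"

lemma diag_form_unit:
  assumes "finite A" "a \<in> A"
  shows "diag_form A (unit_vec a) y = y a" "diag_form A x (unit_vec a) = x a"
  using assms by (auto simp: diag_form_def unit_vec_def if_distrib if_distribR sum.delta cong: if_cong)

lemma schur_diag_form:
  assumes "finite A" "a \<in> A"
  shows "schur (unit_vec a) (diag_form A) = diag_form (A - {a})"
proof (intro ext)
  fix x y
  have "diag_form A x y = x a * y a + diag_form (A - {a}) x y"
    using assms by (simp add: diag_form_def sum.remove)
  then show "schur (unit_vec a) (diag_form A) x y = diag_form (A - {a}) x y"
    by (simp add: schur_def diag_form_unit[OF assms]) (simp add: unit_vec_def)
qed

lemma fold_schur_diag_form:
  assumes "finite A" "set as \<subseteq> A" "distinct as"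
  shows "fold schur (map unit_vec as) (diag_form A) = diag_form (A - set as)"
  using assms
proof (induction as arbitrary: A)
  case (Cons a as)
  have "fold schur (map unit_vec as) (diag_form (A - {a})) = diag_form (A - {a} - set as)"
    using Cons.prems by (intro Cons.IH) auto
  moreover have "A - {a} - set as = A - set (a # as)" by auto
  ultimately show ?case using Cons.prems by (simp add: schur_diag_form)
qed simp

lemma pivots_diag_form:
  assumes "finite A" "set as \<subseteq> A" "distinct as"
  shows "pivots (map unit_vec as) (diag_form A) = 1"
  using assms
proof (induction as arbitrary: A)
  case (Cons a as)
  have "pivots (map unit_vec as) (diag_form (A - {a})) = 1"
    using Cons.prems by (intro Cons.IH) auto
  then show ?case using Cons.prems by (simp add: schur_diag_form diag_form_unit) (simp add: unit_vec_def)
qed simp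

section \<open>Gram forms of configurations\<close>

text \<open>\<open>gram n x\<close> is the Gram form of the vectors \<open>p\<^sub>i - p\<^sub>1\<close> recovered by polarization from the
  squared lengths \<open>x\<close>.\<close>

definition sqlen :: "(nat \<times> nat \<Rightarrow> complex) \<Rightarrow> nat \<Rightarrow> nat \<Rightarrow> complex" where
  "sqlen x i j = (if i < j then x (i, j) else if j < i then x (j, i) else 0)"

definition gram :: "nat \<Rightarrow> (nat \<times> nat \<Rightarrow> complex) \<Rightarrow> (nat \<Rightarrow> complex) \<Rightarrow> (nat \<Rightarrow> complex) \<Rightarrow> complex" where
  "gram n x = (\<lambda>v w. \<Sum>i=1..n. \<Sum>j=1..n. v i * w j * ((sqlen x 1 i + sqlen x 1 j - sqlen x i j) / 2))"

lemma sqlen_sym: "sqlen x i j = sqlen x j i"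
  by (simp add: sqlen_def)

lemma gram_sym: "gram n x v w = gram n x w v"
  unfolding gram_def
  by (subst sum.swap) (auto intro!: sum.cong simp: sqlen_sym[of x] add_ac mult_ac)

lemma gram_add: "gram n x (\<lambda>i. u i + v i) w = gram n x u w + gram n x v w"
  by (simp add: gram_def distrib_right sum.distrib add_divide_distrib)

lemma gram_unit:
  assumes "i \<in> {1..n}" "j \<in> {1..n}"
  shows "gram n x (unit_vec i) (unit_vec j) = (sqlen x 1 i + sqlen x 1 j - sqlen x i j) / 2"
proof -
  let ?c = "\<lambda>i j. (sqlen x 1 i + sqlen x 1 j - sqlen x i j) / 2"
  have "gram n x (unit_vec i) (unit_vec j)
      = (\<Sum>i'=1..n. \<Sum>j'=1..n. if j' = j then (if i' = i then ?c i' j' else 0) else 0)"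
    unfolding gram_def by (intro sum.cong refl) (auto simp: unit_vec_def)
  then show ?thesis using assms by simp
qed

lemma gram_unit_1: "gram n x (unit_vec 1) w = 0"
  unfolding gram_def
proof (intro sum.neutral ballI)
  fix i j assume "i \<in> {1..n}" "j \<in> {1..n}"
  show "unit_vec 1 i * w j * ((sqlen x 1 i + sqlen x 1 j - sqlen x i j) / 2) = 0"
    by (cases "i = 1") (auto simp: unit_vec_def sqlen_def)
qed

lemma sqlen_meas:
  assumes "i \<in> {1..n}" "j \<in> {1..n}"
  shows "sqlen (meas d n p) i j = (\<Sum>k=1..d. (p i k - p j k)\<^sup>2)"
  using assms by (auto simp: sqlen_def meas_def pair_idx_def power2_commute intro!: sum.cong)

text \<open>The law of cosines, coordinate by coordinate.\<close>

lemma gram_meas: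
  "gram n (meas d n p) v w =
    (\<Sum>i=1..n. \<Sum>j=1..n. v i * w j * (\<Sum>k=1..d. (p i k - p 1 k) * (p j k - p 1 k)))"
  unfolding gram_def
proof (intro sum.cong refl arg_cong2[where f = times])
  fix i j assume ij: "i \<in> {1..n}" "j \<in> {1..n}"
  then have "1 \<in> {1..n}" by auto
  then show "(sqlen (meas d n p) 1 i + sqlen (meas d n p) 1 j - sqlen (meas d n p) i j) / 2
      = (\<Sum>k=1..d. (p i k - p 1 k) * (p j k - p 1 k))"
    unfolding sqlen_meas[OF \<open>1 \<in> {1..n}\<close> ij(1)] sqlen_meas[OF \<open>1 \<in> {1..n}\<close> ij(2)] sqlen_meas[OF ij]
    by (simp flip: sum.distrib sum_subtractf add: sum_divide_distrib)
      (auto intro!: sum.cong simp: power2_eq_square field_simps)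
qed

lemma rank_le_gram_meas: "rank_le d (gram n (meas d n p))"
proof -
  let ?f = "\<lambda>k v. \<Sum>i=1..n. v i * (p i k - p 1 k)"
  have "gram n (meas d n p) v w = (\<Sum>k=1..d. ?f k v * ?f k w)" for v w
  proof -
    have "gram n (meas d n p) v w
        = (\<Sum>i=1..n. \<Sum>j=1..n. \<Sum>k=1..d. v i * (p i k - p 1 k) * (w j * (p j k - p 1 k)))"
      unfolding gram_meas by (simp add: sum_distrib_left mult_ac)
    also have "\<dots> = (\<Sum>i=1..n. \<Sum>k=1..d. \<Sum>j=1..n. v i * (p i k - p 1 k) * (w j * (p j k - p 1 k)))"
      by (intro sum.cong refl sum.swap)
    also have "\<dots> = (\<Sum>k=1..d. \<Sum>i=1..n. \<Sum>j=1..n. v i * (p i k - p 1 k) * (w j * (p j k - p 1 k)))"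
      by (rule sum.swap)
    finally show ?thesis by (simp add: sum_product)
  qed
  then show ?thesis unfolding rank_le_def
    by (intro exI[of _ "{1..d}"] exI[of _ ?f]) simp
qed

text \<open>Squared lengths are recovered from the Gram entries as
  \<open>g i i + g j j - 2 * g i j\<close>. The shift \<open>c - 1\<close> matches the coordinates
  of \<open>meas\<close>, which start at 1.\<close>

lemma gram_reconstruct:
  assumes "x \<in> aff (pair_idx n)" "\<And>v w. gram n x v w = (\<Sum>k<d. q k v * q k w)"
  shows "x = meas d n (\<lambda>i c. q (c - 1) (unit_vec i))"
proof (rule ext, rule prod.exhaust)
  fix e i j assume e: "e = (i :: nat, j :: nat)"
  show "x e = meas d n (\<lambda>i c. q (c - 1) (unit_vec i)) e"
  proof (cases "(i, j) \<in> pair_idx n")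
    case True
    then have ij: "i \<in> {1..n}" "j \<in> {1..n}" "i < j" by (auto simp: pair_idx_def)
    let ?g = "\<lambda>i j. gram n x (unit_vec i) (unit_vec j)"
    have "(\<Sum>c=1..d. (q (c - 1) (unit_vec i) - q (c - 1) (unit_vec j))\<^sup>2)
        = (\<Sum>c<d. (q c (unit_vec i) - q c (unit_vec j))\<^sup>2)"
      by (rule sum.reindex_bij_witness[of _ Suc "\<lambda>c. c - 1"]) auto
    also have "\<dots> = ?g i i + ?g j j - 2 * ?g i j"
      unfolding assms(2) by (simp add: sum_distrib_left power2_eq_square algebra_simps
          flip: sum.distrib sum_subtractf)
    also have "\<dots> = x (i, j)"
      unfolding gram_unit[OF ij(1,1)] gram_unit[OF ij(2,2)] gram_unit[OF ij(1,2)]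
      using ij(3) by (simp add: sqlen_def field_simps)
    finally show ?thesis using True by (simp add: meas_def e)
  next
    case False
    then show ?thesis using assms(1) by (simp add: aff_def meas_def e)
  qed
qed

lemma finite_pair_idx: "finite (pair_idx n)"
  by (rule finite_subset[of _ "{1..n} \<times> {1..n}"]) (auto simp: pair_idx_def)

lemma poly_fun_gram:
  assumes "\<And>e. e \<in> pair_idx n \<Longrightarrow> (\<lambda>y. X y e) \<in> poly_fun I"
  shows "(\<lambda>y. gram n (X y) v w) \<in> poly_fun I"
proof -
  have ext: "(\<lambda>y. sqlen (X y) i j) \<in> poly_fun I" if "i \<in> {1..n}" "j \<in> {1..n}" for i j
    using that assms[of "(i, j)"] assms[of "(j, i)"] poly_fun.const[of 0 I]
    by (cases i j rule: linorder_cases) (auto simp: sqlen_def pair_idx_def)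
  have "(\<lambda>y. (1/2) * (sqlen (X y) 1 i + sqlen (X y) 1 j - sqlen (X y) i j)) \<in> poly_fun I"
    if "i \<in> {1..n}" "j \<in> {1..n}" for i j
    using that by (intro poly_fun_cmult poly_fun_diff poly_fun.add ext) auto
  then show ?thesis unfolding gram_def by (intro poly_fun_sum poly_fun_cmult) simp
qed

lemma poly_fun_gram_sq:
  "(\<lambda>x. fold schur vs (gram n (sq_map x)) v w) \<in> poly_fun (pair_idx n)"
  unfolding sq_map_def by (intro poly_fun_fold_schur poly_fun_gram poly_fun_power poly_fun.var)

text \<open>The defining equations run over all lists of \<open>d\<close> vectors, an infinite
  family, as \<open>sum_of_squares\<close> may choose any vectors as pivots.\<close>

lemma zariski_closed_L_set: "zariski_closed (pair_idx n) (L_set d n)"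
proof -
  define F where "F = {\<lambda>x. fold schur vs (gram n (sq_map x)) v w | vs v w. length vs = d}"
  have "F \<subseteq> poly_fun (pair_idx n)" unfolding F_def using poly_fun_gram_sq by blast
  moreover have "x \<in> L_set d n \<longleftrightarrow> (\<forall>f\<in>F. f x = 0)" if x: "x \<in> aff (pair_idx n)" for x
  proof
    assume "x \<in> L_set d n"
    then obtain p where p: "sq_map x = meas d n p" by (auto simp: L_set_def M_set_def)
    show "\<forall>f\<in>F. f x = 0"
      unfolding F_def using rank_le_fold_schur[of _ "gram n (sq_map x)"] rank_le_gram_meas[of d n p]
      by (auto simp: p)
  next
    assume F: "\<forall>f\<in>F. f x = 0"
    have "fold schur vs (gram n (sq_map x)) v w = 0" if "length vs = d" for vs v w
    proof -
      have "(\<lambda>x. fold schur vs (gram n (sq_map x)) v w) \<in> F"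
        unfolding F_def by (intro CollectI exI[of _ vs] exI[of _ v] exI[of _ w]) (simp add: that)
      from bspec[OF F this] show ?thesis .
    qed
    from sum_of_squares[OF gram_sym gram_add this] obtain q
      where q: "\<forall>v w. gram n (sq_map x) v w = (\<Sum>k<d. q k v * q k w)" ..
    have "sq_map x \<in> aff (pair_idx n)" using x by (auto simp: aff_def sq_map_def)
    from gram_reconstruct[OF this q[rule_format]] x show "x \<in> L_set d n"
      by (auto simp: L_set_def M_set_def)
  qed
  ultimately show ?thesis
    unfolding zariski_closed_def by (intro exI[of _ F]) (auto simp: L_set_def)
qed

text \<open>Normal form modulo rigid motions: point \<open>i\<close> may use only the axes below
  \<open>i\<close>, so point 1 is the origin.\<close>

definition tri :: "nat \<Rightarrow> nat \<Rightarrow> (nat \<times> nat) set" where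
  "tri d n = {(i, c). 1 \<le> c \<and> c \<le> d \<and> c < i \<and> i \<le> n}"

lemma poly_deg_meas: "poly_deg UNIV 2 (\<lambda>y. meas d n (curry y) e)"
proof (cases "e \<in> pair_idx n")
  case True
  have lin: "poly_deg UNIV 1 (\<lambda>y. y u - y v)" for u v :: "nat \<times> nat"
    using poly_deg.add[OF poly_deg_var[of u UNIV] poly_deg_cmult[OF poly_deg_var[of v UNIV], of "-1"]]
    by simp
  show ?thesis using True poly_deg_power[OF lin, of 2]
    by (cases e) (auto simp: meas_def curry_def intro!: poly_deg_sum)
next
  case False
  then show ?thesis by (cases e) (auto simp: meas_def intro: poly_deg.const)
qed

lemma poly_fun_meas: "(\<lambda>y. meas d n (curry y) e) \<in> poly_fun UNIV"
  by (rule poly_deg_imp_poly_fun[OF poly_deg_meas])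

text \<open>An orthonormal frame: point \<open>i\<close> of \<open>A\<close> is the unit vector on
  axis \<open>\<kappa> i\<close>, all other points are at the origin. It witnesses that pivots and
  complements are not identically zero.\<close>

definition frame :: "nat set \<Rightarrow> (nat \<Rightarrow> nat) \<Rightarrow> nat \<times> nat \<Rightarrow> complex" where
  "frame A \<kappa> = (\<lambda>(i, k). if i \<in> A \<and> k = \<kappa> i then 1 else 0)"

lemma gram_frame:
  assumes "A \<subseteq> {2..n}" "\<kappa> ` A \<subseteq> {1..d}" "inj_on \<kappa> A"
  shows "gram n (meas d n (curry (frame A \<kappa>))) = diag_form A"
proof (intro ext)
  fix v w
  have one: "1 \<notin> A" using assms(1) by auto
  have ent: "(\<Sum>k=1..d. (curry (frame A \<kappa>) i k - curry (frame A \<kappa>) 1 k) *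
      (curry (frame A \<kappa>) j k - curry (frame A \<kappa>) 1 k)) = (if j = i then if i \<in> A then 1 else 0 else 0)" for i j
  proof -
    have "(\<Sum>k=1..d. (curry (frame A \<kappa>) i k - curry (frame A \<kappa>) 1 k) *
        (curry (frame A \<kappa>) j k - curry (frame A \<kappa>) 1 k))
      = (\<Sum>k=1..d. if k = \<kappa> i then (if i \<in> A \<and> j = i then 1 else 0) else 0)"
      using one assms(3) by (intro sum.cong) (auto simp: frame_def curry_def inj_on_def)
    then show ?thesis using assms(2) by (auto simp: image_subset_iff)
  qed
  have "gram n (meas d n (curry (frame A \<kappa>))) v w
      = (\<Sum>i=1..n. \<Sum>j=1..n. if j = i then (if i \<in> A then v i * w i else 0) else 0)"
    unfolding gram_meas ent by (intro sum.cong refl) auto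
  also have "\<dots> = (\<Sum>i=1..n. if i \<in> A then v i * w i else 0)"
    by (intro sum.cong refl) (simp add: sum.delta)
  also have "\<dots> = (\<Sum>i\<in>{1..n} \<inter> A. v i * w i)" by (simp add: sum.If_cases)
  also have "{1..n} \<inter> A = A" using assms(1) by auto
  finally show "gram n (meas d n (curry (frame A \<kappa>))) v w = diag_form A v w" unfolding diag_form_def .
qed

text \<open>Generic configurations are congruent to triangular ones, by the Cholesky factorization of
  the Gram form.\<close>

lemma tri_dense:
  assumes "d < n" "f \<in> poly_fun (pair_idx n)"
    and "\<And>y. y \<in> aff (tri d n) \<Longrightarrow> f (meas d n (curry y)) = 0"
  shows "f (meas d n p) = 0"
proof (rule ccontr)
  assume fp: "f (meas d n p) \<noteq> 0"
  \<comment> \<open>The \<open>d\<close> points after point 1; they exist because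
    \<open>d < n\<close>.\<close>
  define as where "as = [2..<d+2]"
  define piv where "piv = (\<lambda>y. pivots (map unit_vec as) (gram n (meas d n (curry y))))"
  have piv: "piv \<in> poly_fun UNIV"
    unfolding piv_def by (intro poly_fun_pivots poly_fun_gram poly_fun_meas)
  have fpoly: "(\<lambda>y. f (meas d n (curry y))) \<in> poly_fun UNIV"
    by (rule poly_fun_compose[OF assms(2) poly_fun_meas])
  have "gram n (meas d n (curry (frame (set as) (\<lambda>i. i - 1)))) = diag_form (set as)"
    using assms(1) by (intro gram_frame) (auto simp: as_def inj_on_def)
  then have "piv (frame (set as) (\<lambda>i. i - 1)) \<noteq> 0"
    by (simp add: piv_def pivots_diag_form as_def)
  moreover have "f (meas d n (curry (\<lambda>(i, k). p i k))) \<noteq> 0" using fp by (simp add: curry_def)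
  ultimately obtain y where y: "f (meas d n (curry y)) \<noteq> 0" "piv y \<noteq> 0"
    using poly_fun_nonzero_common[OF fpoly piv, of "\<lambda>(i, k). p i k" UNIV] by (auto simp: aff_def)
  let ?G = "gram n (meas d n (curry y))"
  have len: "length (map unit_vec as) = d" unfolding as_def length_map length_upt by simp
  have "fold schur (map unit_vec as) ?G u v = 0" for u v
    using rank_le_fold_schur[of "map unit_vec as" ?G] rank_le_gram_meas len by metis
  from cholesky[OF gram_sym y(2)[unfolded piv_def] this, unfolded len] obtain q
    where Q: "(\<forall>u v. ?G u v = (\<Sum>k<d. q k u * q k v)) \<and>
      (\<forall>k<d. \<forall>b<k. q k (map unit_vec as ! b) = 0) \<and>
      (\<forall>k<d. \<forall>z. (\<forall>y. ?G z y = 0) \<longrightarrow> q k z = 0)" ..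
  note q = conjunct1[OF Q, rule_format] conjunct1[OF conjunct2[OF Q], rule_format]
    conjunct2[OF conjunct2[OF Q], rule_format]
  define z where "z = (\<lambda>(i, c). if (i, c) \<in> tri d n then q (c - 1) (unit_vec i) else 0)"
  \<comment> \<open>Cutting \<open>q\<close> down to \<open>tri d n\<close> loses nothing: for
    \<open>i = 1\<close> the radical clause applies, and for the other points with
    \<open>i \<le> c\<close> triangularity, point \<open>i\<close> being entry \<open>i - 2\<close>
    of \<open>as\<close>.\<close>
  have z: "z (i, c) = q (c - 1) (unit_vec i)" if "i \<in> {1..n}" "c \<in> {1..d}" for i c
  proof (cases "c < i")
    case False
    have "q (c - 1) (unit_vec i) = 0"
    proof (cases "i = 1")
      case True
      then show ?thesis using q(3)[of "c - 1" "unit_vec 1"] gram_unit_1 that by auto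
    next
      case i: False
      have "2 + (i - 2) < d + 2" "2 + (i - 2) = i" using i False that by auto
      then have "map unit_vec as ! (i - 2) = unit_vec i"
        using nth_upt[of 2 "i - 2" "d + 2"] len by (simp add: as_def del: upt_Suc)
      then show ?thesis using q(2)[of "c - 1" "i - 2"] False i that by auto
    qed
    then show ?thesis by (simp add: z_def)
  qed (use that in \<open>auto simp: z_def tri_def\<close>)
  have "meas d n (curry y) \<in> aff (pair_idx n)" by (auto simp: aff_def meas_def)
  from gram_reconstruct[OF this q(1)]
  have "meas d n (curry y) = meas d n (\<lambda>i c. q (c - 1) (unit_vec i))" .
  also have "\<dots> = meas d n (curry z)"
    unfolding meas_def by (intro ext) (auto simp: curry_def z pair_idx_def intro!: sum.cong)
  finally have "f (meas d n (curry z)) \<noteq> 0" using y(1) by simp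
  moreover have "z \<in> aff (tri d n)" by (auto simp: aff_def z_def)
  ultimately show False using assms(3) by blast
qed

section \<open>Strata of signed configurations\<close>

text \<open>\<open>J\<close> is the set of coordinates (i, c) of the points that are allowed to be nonzero. Pairs of
  points that are confined to the first axis have a rational signed distance, and the sign
  \<open>\<epsilon>\<close> selects one of its two branches.\<close>

definition quad :: "nat \<Rightarrow> (nat \<times> nat) set \<Rightarrow> (nat \<times> nat) set" where
  "quad n J = {(a, b) \<in> pair_idx n. (a, 2) \<in> J \<or> (b, 2) \<in> J}"

definition lengths :: "nat \<Rightarrow> nat \<Rightarrow> (nat \<times> nat \<Rightarrow> complex) \<Rightarrow> (nat \<times> nat) set \<Rightarrow>
    (nat \<times> nat \<Rightarrow> complex) \<Rightarrow> nat \<times> nat \<Rightarrow> complex" where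
  "lengths d n \<epsilon> J y e =
     (if e \<in> quad n J then meas d n (curry y) e else \<epsilon> e * (y (fst e, 1) - y (snd e, 1)))"

definition stratum :: "nat \<Rightarrow> nat \<Rightarrow> (nat \<times> nat \<Rightarrow> complex) \<Rightarrow> (nat \<times> nat) set \<Rightarrow> (nat \<times> nat \<Rightarrow> complex) set" where
  "stratum d n \<epsilon> J = cover (pair_idx n) (quad n J) J (lengths d n \<epsilon> J)"

text \<open>Coordinates are released from the first axis upwards, so coordinate 2 decides whether a
  point has left that axis. Once one point has, points 2 to \<open>n\<close> are free on the first
  axis, which leaves room for the generic position \<open>p0\<close> below.\<close>

definition staircase :: "nat \<Rightarrow> nat \<Rightarrow> (nat \<times> nat) set \<Rightarrow> bool" where
  "staircase d n J \<longleftrightarrow> J \<subseteq> {1..n} \<times> {1..d} \<and>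
     (\<forall>i c c'. (i, c) \<in> J \<longrightarrow> 1 \<le> c' \<longrightarrow> c' \<le> c \<longrightarrow> (i, c') \<in> J) \<and>
     (\<forall>i. (i, 2) \<in> J \<longrightarrow> {2..n} \<times> {1} \<subseteq> J)"

text \<open>With point \<open>i\<close> at \<open>x ^ i\<close> on an axis and velocities
  \<open>s\<close>, these conditions say that the linear squared lengths are nonzero with distinct
  roots. Each failure is a root of a nonzero polynomial in \<open>x\<close>, since a binomial
  determines its two exponents.\<close>

lemma separating_points:
  fixes s :: "nat \<Rightarrow> complex"
  assumes "finite E" "\<And>a b. (a, b) \<in> E \<Longrightarrow> a < b \<and> s a \<noteq> s b"
  shows "\<exists>x::complex. (\<forall>(a, b)\<in>E. x ^ a \<noteq> x ^ b) \<and>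
    (\<forall>(a, b)\<in>E. \<forall>(a', b')\<in>E. (a, b) \<noteq> (a', b') \<longrightarrow>
       (x ^ a - x ^ b) * (s a' - s b') \<noteq> (x ^ a' - x ^ b') * (s a - s b))"
proof -
  define P where "P = (\<lambda>(a, b). monom 1 a - monom 1 b :: complex poly)"
  define \<sigma> where "\<sigma> = (\<lambda>(a, b). s a - s b)"
  define Q where "Q = (\<lambda>e e'. smult (\<sigma> e') (P e) - smult (\<sigma> e) (P e'))"
  define R where "R = P ` E \<union> (\<Union>e\<in>E. Q e ` (E - {e}))"
  have fin: "finite R" using assms(1) by (simp add: R_def)
  have P0: "P e \<noteq> 0" if e: "e \<in> E" for e
  proof
    obtain a b where ab: "e = (a, b)" by force
    assume "P e = 0"
    then have "coeff (P e) b = 0" by simp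
    then show False using assms(2)[of a b] e by (simp add: P_def ab)
  qed
  have Q0: "Q e e' \<noteq> 0" if e: "e \<in> E" "e' \<in> E" "e \<noteq> e'" for e e'
  proof
    obtain a b a' b' where ab: "e = (a, b)" "e' = (a', b')" by force
    have ord: "a < b" "a' < b'" "s a \<noteq> s b" "s a' \<noteq> s b'" using assms(2) e ab by auto
    assume "Q e e' = 0"
    then have c: "coeff (Q e e') k = 0" for k by simp
    have ck: "coeff (Q e e') k = (s a' - s b') * ((if a = k then 1 else 0) - (if b = k then 1 else 0))
        - (s a - s b) * ((if a' = k then 1 else 0) - (if b' = k then 1 else 0))" for k
      by (simp add: Q_def P_def \<sigma>_def ab)
    have b: "b = b'"
    proof (cases b b' rule: linorder_cases)
      case less
      then show ?thesis using c[of b'] ord unfolding ck by simp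
    next
      case greater
      then show ?thesis using c[of b] ord unfolding ck by simp
    qed
    have "a = a'"
    proof (rule ccontr)
      assume "a \<noteq> a'"
      then show False using c[of a] ord b unfolding ck by simp
    qed
    then show False using b e(3) ab by simp
  qed
  have "0 \<notin> R" using P0[symmetric] Q0[symmetric] unfolding R_def by blast
  then have "\<Prod>R \<noteq> 0" using fin by (simp add: prod_zero_iff)
  then have "finite {x. poly (\<Prod>R) x = 0}" by (rule poly_roots_finite)
  then obtain x where "poly (\<Prod>R) x \<noteq> 0"
    using infinite_UNIV_char_0[where 'a = complex] by (metis (mono_tags) UNIV_eq_I mem_Collect_eq)
  then have x: "poly p x \<noteq> 0" if "p \<in> R" for p
    using that fin by (auto simp: poly_prod prod_zero_iff)
  have "x ^ a \<noteq> x ^ b" if "(a, b) \<in> E" for a b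
  proof -
    have "P (a, b) \<in> R" unfolding R_def using that by blast
    from x[OF this] show ?thesis by (simp add: P_def poly_monom)
  qed
  moreover have "(x ^ a - x ^ b) * (s a' - s b') \<noteq> (x ^ a' - x ^ b') * (s a - s b)"
    if "(a, b) \<in> E" "(a', b') \<in> E" "(a, b) \<noteq> (a', b')" for a b a' b'
  proof -
    have "Q (a, b) (a', b') \<in> R" unfolding R_def using that by blast
    then show ?thesis using x[of "Q (a, b) (a', b')"]
      by (auto simp: Q_def P_def \<sigma>_def poly_monom mult_ac)
  qed
  ultimately show ?thesis by blast
qed

text \<open>Moving the points that are off the axis along the isotropic direction \<open>(1, \<i>, 0, \<dots>)\<close>
  makes all squared distances linear in the time parameter.\<close>

lemma meas_isotropic_line:
  fixes s :: "nat \<Rightarrow> complex"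
  assumes "2 \<le> d" "(a, b) \<in> pair_idx n"
  defines "w \<equiv> \<lambda>(i, c). s i * (if c = 1 then 1 else if c = (2::nat) then \<i> else 0)"
  shows "meas d n (curry (\<lambda>v. y v + t * w v)) (a, b) =
    meas d n (curry y) (a, b) + t * (2 * (s a - s b) * ((y (a, 1) - y (b, 1)) + \<i> * (y (a, 2) - y (b, 2))))"
proof -
  have d: "{1..d} = insert 1 (insert 2 {3..d})" using assms(1) by auto
  have rest: "(\<Sum>k\<in>{3..d}. (y (a, k) + t * w (a, k) - (y (b, k) + t * w (b, k)))\<^sup>2)
      = (\<Sum>k\<in>{3..d}. (y (a, k) - y (b, k))\<^sup>2)"
    by (intro sum.cong) (auto simp: w_def)
  have "meas d n (curry (\<lambda>v. y v + t * w v)) (a, b)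
      = (\<Sum>k\<in>{1..d}. (y (a, k) + t * w (a, k) - (y (b, k) + t * w (b, k)))\<^sup>2)"
    using assms(2) by (simp add: meas_def)
  also have "\<dots> = (y (a, 1) + t * s a - (y (b, 1) + t * s b))\<^sup>2
      + ((y (a, 2) + t * (s a * \<i>) - (y (b, 2) + t * (s b * \<i>)))\<^sup>2
      + (\<Sum>k\<in>{3..d}. (y (a, k) - y (b, k))\<^sup>2))"
    unfolding d by (simp add: rest) (simp add: w_def)
  \<comment> \<open>The coefficient of \<open>t\<close> squared carries the factor
    \<open>1 + \<i>\<^sup>2\<close>, which is zero.\<close>
  also have "\<dots> = ((y (a, 1) - y (b, 1))\<^sup>2 + ((y (a, 2) - y (b, 2))\<^sup>2
      + (\<Sum>k\<in>{3..d}. (y (a, k) - y (b, k))\<^sup>2)))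
      + t * (2 * (s a - s b) * ((y (a, 1) - y (b, 1)) + \<i> * (y (a, 2) - y (b, 2))))
      + (t * (s a - s b))\<^sup>2 * (1 + \<i>\<^sup>2)"
    by (simp add: power2_eq_square) (simp add: algebra_simps)
  also have "(y (a, 1) - y (b, 1))\<^sup>2 + ((y (a, 2) - y (b, 2))\<^sup>2
      + (\<Sum>k\<in>{3..d}. (y (a, k) - y (b, k))\<^sup>2)) = meas d n (curry y) (a, b)"
    using assms(2) unfolding meas_def d by simp
  finally show ?thesis by (simp only: power2_i) simp
qed

lemma poly_fun_lengths: "(\<lambda>y. lengths d n \<epsilon> J y e) \<in> poly_fun UNIV"
  using poly_fun_meas[of d n e]
  by (cases "e \<in> quad n J")
    (auto simp: lengths_def intro!: poly_fun_cmult poly_fun_diff poly_fun.var)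

lemma prime_on_stratum:
  assumes J: "staircase d n J"
  shows "prime_on (pair_idx n) (stratum d n \<epsilon> J)"
proof (cases "quad n J = {}")
  case True
  show ?thesis unfolding stratum_def True
    by (rule prime_on_cover[where w = "\<lambda>_. 0" and ?p0.0 = "\<lambda>_. 0"])
      (auto intro: finite_pair_idx poly_fun_lengths simp: aff_def)
next
  case False
  then obtain i where i: "(i, 2) \<in> J" by (auto simp: quad_def)
  then have d: "2 \<le> d" and line: "{2..n} \<times> {1} \<subseteq> J" using J by (auto simp: staircase_def)
  have down: "(i, 1) \<in> J" if "(i, 2) \<in> J" for i
    using J that unfolding staircase_def by fastforce
  \<comment> \<open>Points on the axis rest and the others have distinct nonzero velocities, so
    every pair in \<open>quad n J\<close> has different velocities.\<close>
  define s :: "nat \<Rightarrow> complex" where "s = (\<lambda>i. if (i, 2) \<in> J then of_nat i else 0)"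
  define w where "w = (\<lambda>(i, c). s i * (if c = 1 then 1 else if c = (2::nat) then \<i> else 0))"
  define \<beta> where "\<beta> = (\<lambda>e y. 2 * (s (fst e) - s (snd e)) * ((y (fst e, 1::nat) - y (snd e, 1))
    + \<i> * (y (fst e, 2) - y (snd e, 2))))"
  have s: "s a \<noteq> s b" "a < b" "1 \<le> a" "b \<le> n" if "(a, b) \<in> quad n J" for a b
    using that by (auto simp: quad_def s_def pair_idx_def)
  have "finite (quad n J)" by (rule finite_subset[OF _ finite_pair_idx]) (auto simp: quad_def)
  from separating_points[OF this conjI[OF s(2,1)]] obtain x :: complex
    where X: "(\<forall>(a, b)\<in>quad n J. x ^ a \<noteq> x ^ b) \<and>
      (\<forall>(a, b)\<in>quad n J. \<forall>(a', b')\<in>quad n J. (a, b) \<noteq> (a', b') \<longrightarrow>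
         (x ^ a - x ^ b) * (s a' - s b') \<noteq> (x ^ a' - x ^ b') * (s a - s b))" ..
  have x1: "x ^ a \<noteq> x ^ b" if "(a, b) \<in> quad n J" for a b
    using bspec[OF conjunct1[OF X] that] by simp
  have x2: "(x ^ a - x ^ b) * (s a' - s b') \<noteq> (x ^ a' - x ^ b') * (s a - s b)"
    if "(a, b) \<in> quad n J" "(a', b') \<in> quad n J" "(a, b) \<noteq> (a', b')" for a b a' b'
    using bspec[OF bspec[OF conjunct2[OF X] that(1), unfolded prod.case] that(2)] that(3) by simp
  \<comment> \<open>Subtracting \<open>x ^ 1\<close> puts point 1 at the origin, as its coordinates
    may lie outside \<open>J\<close>; differences are unaffected.\<close>
  define p0 where "p0 = (\<lambda>(i, c). if c = (1::nat) \<and> i \<in> {1..n} then x ^ i - x ^ 1 else 0)"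
  have Y0: "lengths d n \<epsilon> J p0 (a, b) = (x ^ a - x ^ b)\<^sup>2" if e: "(a, b) \<in> quad n J" for a b
  proof -
    have "(\<Sum>k=1..d. (p0 (a, k) - p0 (b, k))\<^sup>2) = (\<Sum>k=1..d. if k = 1 then (x ^ a - x ^ b)\<^sup>2 else 0)"
      using s[OF e] by (intro sum.cong) (auto simp: p0_def)
    then show ?thesis using e d by (simp add: lengths_def meas_def quad_def)
  qed
  have \<beta>0: "\<beta> (a, b) p0 = 2 * (s a - s b) * (x ^ a - x ^ b)" if e: "(a, b) \<in> quad n J" for a b
    using s[OF e] by (simp add: \<beta>_def p0_def)
  show ?thesis unfolding stratum_def
  proof (rule prime_on_cover[where w = w and ?p0.0 = p0 and \<beta> = \<beta>])
    show "w \<in> aff J" using down by (auto simp: aff_def w_def s_def)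
    show "p0 \<in> aff J"
      unfolding aff_def
    proof (intro CollectI allI impI)
      fix v assume v: "v \<notin> J"
      obtain i c where ic: "v = (i, c)" by force
      have "i \<notin> {2..n}" if "c = 1" using v line that ic by blast
      then show "p0 v = 0" by (cases "i = 1") (auto simp: ic p0_def)
    qed
    show "\<beta> e \<in> poly_fun UNIV" for e
      unfolding \<beta>_def by (intro poly_fun_cmult poly_fun.add poly_fun_diff poly_fun.var UNIV_I)
    show "lengths d n \<epsilon> J (\<lambda>v. p v + t * w v) e = lengths d n \<epsilon> J p e + t * \<beta> e p"
      if "e \<in> quad n J" for e p t
      using meas_isotropic_line[OF d, of "fst e" "snd e" n p t s] that
      by (auto simp: lengths_def quad_def \<beta>_def w_def)
    show "lengths d n \<epsilon> J p0 e \<noteq> 0" if "e \<in> quad n J" for e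
      using that x1[of "fst e" "snd e"] Y0[of "fst e" "snd e"] by simp
    show "\<beta> e p0 \<noteq> 0" if "e \<in> quad n J" for e
      using that x1[of "fst e" "snd e"] s(1)[of "fst e" "snd e"] \<beta>0[of "fst e" "snd e"] by simp
    show "lengths d n \<epsilon> J p0 e * \<beta> e' p0 \<noteq> lengths d n \<epsilon> J p0 e' * \<beta> e p0"
      if e: "e \<in> quad n J" "e' \<in> quad n J" "e \<noteq> e'" for e e'
    proof -
      obtain a b a' b' where ab: "e = (a, b)" "e' = (a', b')" by force
      let ?\<xi> = "x ^ a - x ^ b" and ?\<xi>' = "x ^ a' - x ^ b'"
      have "?\<xi> * (s a' - s b') \<noteq> ?\<xi>' * (s a - s b)" "?\<xi> \<noteq> 0" "?\<xi>' \<noteq> 0"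
        using x2[of a b a' b'] x1 e ab by auto
      then have "2 * ?\<xi> * ?\<xi>' * (?\<xi> * (s a' - s b')) \<noteq> 2 * ?\<xi> * ?\<xi>' * (?\<xi>' * (s a - s b))" by simp
      moreover have "lengths d n \<epsilon> J p0 e * \<beta> e' p0 = 2 * ?\<xi> * ?\<xi>' * (?\<xi> * (s a' - s b'))"
        "lengths d n \<epsilon> J p0 e' * \<beta> e p0 = 2 * ?\<xi> * ?\<xi>' * (?\<xi>' * (s a - s b))"
        using Y0[OF e(1)[unfolded ab]] Y0[OF e(2)[unfolded ab]] \<beta>0[OF e(1)[unfolded ab]]
          \<beta>0[OF e(2)[unfolded ab]] unfolding ab by (simp_all only: power2_eq_square mult_ac)
      ultimately show ?thesis by simp
    qed
  qed (auto intro: finite_pair_idx poly_fun_lengths simp: quad_def)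
qed

section \<open>Strata as subsets of the variety\<close>

lemma stratum_subset_aff: "stratum d n \<epsilon> J \<subseteq> aff (pair_idx n)"
  by (auto simp: stratum_def cover_def)

text \<open>Outside \<open>quad n J\<close> the staircase condition leaves both points only their
  first coordinate, so the squared length is a square and the sign disappears.\<close>

lemma lengths_axis:
  assumes "staircase d n J" "1 \<le> d" "y \<in> aff J" "e \<in> pair_idx n - quad n J" "(\<epsilon> e)\<^sup>2 = 1"
  shows "(lengths d n \<epsilon> J y e)\<^sup>2 = meas d n (curry y) e"
proof -
  obtain a b where e: "e = (a, b)" by force
  have "y (i, k) = 0" if "i = a \<or> i = b" "k \<in> {1..d}" "k \<noteq> 1" for i k
  proof (rule ccontr)
    assume "y (i, k) \<noteq> 0"
    then have "(i, k) \<in> J" using assms(3) by (auto simp: aff_def)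
    then have "(i, 2) \<in> J" using assms(1) that(2,3) by (auto simp: staircase_def)
    then show False using assms(4) that(1) by (auto simp: quad_def e)
  qed
  then have "(\<Sum>k=1..d. (y (a, k) - y (b, k))\<^sup>2) = (\<Sum>k=1..d. if k = 1 then (y (a, 1) - y (b, 1))\<^sup>2 else 0)"
    by (intro sum.cong) auto
  then show ?thesis using assms(2,4,5)
    by (simp add: lengths_def meas_def e power_mult_distrib)
qed

lemma stratum_sq_map:
  assumes "staircase d n J" "1 \<le> d" "\<forall>e. (\<epsilon> e)\<^sup>2 = 1" "x \<in> stratum d n \<epsilon> J"
  shows "\<exists>y\<in>aff J. sq_map x = meas d n (curry y)"
proof -
  obtain y where y: "y \<in> aff J" "\<And>e. e \<in> pair_idx n \<Longrightarrow>
      if e \<in> quad n J then (x e)\<^sup>2 = lengths d n \<epsilon> J y e else x e = lengths d n \<epsilon> J y e"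
    and x: "x \<in> aff (pair_idx n)"
    using assms(4) by (auto simp: stratum_def cover_def)
  have "sq_map x e = meas d n (curry y) e" for e
  proof (cases "e \<in> pair_idx n")
    case True
    then show ?thesis using y(2)[OF True] lengths_axis[OF assms(1,2) y(1), of e \<epsilon>] spec[OF assms(3), of e]
      by (cases "e \<in> quad n J") (auto simp: sq_map_def, simp add: lengths_def)
  next
    case False
    then show ?thesis using x by (cases e) (auto simp: sq_map_def aff_def meas_def)
  qed
  then show ?thesis using y(1) by blast
qed

lemma stratum_subset_L_set:
  assumes "staircase d n J" "1 \<le> d" "\<forall>e. (\<epsilon> e)\<^sup>2 = 1"
  shows "stratum d n \<epsilon> J \<subseteq> L_set d n"
  proof
  fix x assume x: "x \<in> stratum d n \<epsilon> J"
  then obtain y where "sq_map x = meas d n (curry y)" using stratum_sq_map[OF assms] by blast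
  then show "x \<in> L_set d n" using x stratum_subset_aff[of d n \<epsilon> J] by (auto simp: L_set_def M_set_def)
qed

lemma stratum_fiber:
  assumes "staircase d n J" "1 \<le> d" "\<forall>e. (\<epsilon> e)\<^sup>2 = 1" "y \<in> aff J"
  shows "\<exists>x\<in>stratum d n \<epsilon> J. sq_map x = meas d n (curry y)"
proof -
  define x where "x = (\<lambda>e. if e \<in> quad n J then csqrt (lengths d n \<epsilon> J y e)
    else if e \<in> pair_idx n then lengths d n \<epsilon> J y e else 0)"
  have "x \<in> stratum d n \<epsilon> J" unfolding stratum_def cover_def
    using assms(4) by (auto simp: x_def aff_def quad_def intro!: bexI[of _ y])
  moreover have "sq_map x e = meas d n (curry y) e" for e
  proof (cases "e \<in> pair_idx n")
    case True
    then show ?thesis using lengths_axis[OF assms(1,2,4), of e \<epsilon>] spec[OF assms(3), of e]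
      by (cases "e \<in> quad n J") (auto simp: sq_map_def x_def, simp add: lengths_def)
  next
    case False
    then show ?thesis by (cases e) (auto simp: sq_map_def x_def quad_def meas_def)
  qed
  ultimately show ?thesis by blast
qed

text \<open>A pair that newly enters \<open>quad\<close> trades its signed equation for the square
  of that equation, which is weaker.\<close>

lemma stratum_mono:
  assumes "staircase d n J" "1 \<le> d" "\<forall>e. (\<epsilon> e)\<^sup>2 = 1" "J \<subseteq> J'"
  shows "stratum d n \<epsilon> J \<subseteq> stratum d n \<epsilon> J'"
proof
  fix x assume "x \<in> stratum d n \<epsilon> J"
  then obtain y where y: "y \<in> aff J" "\<And>e. e \<in> pair_idx n \<Longrightarrow>
      if e \<in> quad n J then (x e)\<^sup>2 = lengths d n \<epsilon> J y e else x e = lengths d n \<epsilon> J y e"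
    and x: "x \<in> aff (pair_idx n)"
    by (auto simp: stratum_def cover_def)
  have sub: "quad n J \<subseteq> quad n J'" using assms(4) by (auto simp: quad_def)
  have "if e \<in> quad n J' then (x e)\<^sup>2 = lengths d n \<epsilon> J' y e else x e = lengths d n \<epsilon> J' y e"
    if e: "e \<in> pair_idx n" for e
  proof (cases "e \<in> quad n J")
    case True
    then show ?thesis using y(2)[OF e] sub by (auto simp: lengths_def)
  next
    case False
    then have "x e = lengths d n \<epsilon> J y e" "(x e)\<^sup>2 = meas d n (curry y) e"
      using y(2)[OF e] lengths_axis[OF assms(1,2) y(1), of e \<epsilon>] spec[OF assms(3), of e] e by auto
    then show ?thesis using False by (auto simp: lengths_def)
  qed
  moreover have "y \<in> aff J'" using y(1) assms(4) by (auto simp: aff_def)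
  ultimately show "x \<in> stratum d n \<epsilon> J'"
    unfolding stratum_def cover_def using x by blast
qed

text \<open>With all coordinates free and \<open>d \<ge> 2\<close> every pair lies in
  \<open>quad\<close>, so no sign enters and the variety itself is a single stratum.\<close>

lemma L_set_irreducible:
  assumes "2 \<le> d"
  shows "zariski_irreducible (pair_idx n) (L_set d n)"
proof -
  let ?J = "{1..n} \<times> {1..d}"
  let ?\<epsilon> = "\<lambda>_. 1 :: complex"
  have J: "staircase d n ?J" using assms by (auto simp: staircase_def)
  have quad: "quad n ?J = pair_idx n" using assms by (auto simp: quad_def pair_idx_def)
  have "L_set d n \<subseteq> stratum d n ?\<epsilon> ?J"
  proof
    fix x assume x: "x \<in> L_set d n"
    then obtain p where p: "sq_map x = meas d n p" by (auto simp: L_set_def M_set_def)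
    define y where "y = (\<lambda>(i, k). if (i, k) \<in> ?J then p i k else 0)"
    have "meas d n (curry y) = meas d n p"
      unfolding meas_def by (intro ext) (auto simp: y_def pair_idx_def intro!: sum.cong)
    then have "(x e)\<^sup>2 = meas d n (curry y) e" for e
      using fun_cong[OF p, of e] by (simp add: sq_map_def)
    moreover have "lengths d n ?\<epsilon> ?J y e = meas d n (curry y) e" if "e \<in> pair_idx n" for e
      unfolding lengths_def quad using that by simp
    moreover have "y \<in> aff ?J" by (auto simp: y_def aff_def)
    moreover have "x \<in> aff (pair_idx n)" using x by (simp add: L_set_def)
    ultimately show "x \<in> stratum d n ?\<epsilon> ?J"
      unfolding stratum_def cover_def quad by (auto intro!: bexI[of _ y])
  qed
  then have "stratum d n ?\<epsilon> ?J = L_set d n" using stratum_subset_L_set[OF J, of ?\<epsilon>] assms by auto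
  then show ?thesis
    using prime_on_imp_irreducible[OF _ zariski_closed_L_set] prime_on_stratum[OF J, of ?\<epsilon>] by simp
qed

section \<open>A chain of strata\<close>

text \<open>The coordinates of the triangular configurations are released one at a time, axis by axis.\<close>

definition key :: "nat \<Rightarrow> nat \<times> nat \<Rightarrow> nat" where
  "key n = (\<lambda>(i, c). c * (n + 1) + i)"

definition tri_upto :: "nat \<Rightarrow> nat \<Rightarrow> nat \<Rightarrow> (nat \<times> nat) set" where
  "tri_upto d n t = {z \<in> tri d n. key n z < t}"

lemma finite_tri: "finite (tri d n)"
  by (rule finite_subset[of _ "{1..n} \<times> {1..d}"]) (auto simp: tri_def)

lemma key_less:
  assumes "i \<le> n" "c < c'"
  shows "key n (i, c) < key n (i', c')"
proof -
  have "Suc c * (n + 1) \<le> c' * (n + 1)" using assms(2) by (intro mult_le_mono1) simp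
  then show ?thesis using assms(1) by (simp add: key_def)
qed

lemma key_inj:
  assumes "key n (i, c) = key n (i', c')" "i \<le> n" "i' \<le> n"
  shows "i = i'" "c = c'"
proof -
  show "c = c'" using key_less[of i n c c' i'] key_less[of i' n c' c i] assms
    by (cases c c' rule: linorder_cases) auto
  then show "i = i'" using assms(1) by (simp add: key_def)
qed

text \<open>The order by axes makes this work: lower coordinates of a point come earlier, and the
  whole first axis precedes the second.\<close>

lemma staircase_tri_upto: "staircase d n (tri_upto d n t)"
proof -
  have "(i, c') \<in> tri_upto d n t" if "(i, c) \<in> tri_upto d n t" "1 \<le> c'" "c' \<le> c" for i c c'
  proof (cases "c' = c")
    case False
    then have "key n (i, c') < key n (i, c)" using that by (intro key_less) (auto simp: tri_upto_def tri_def)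
    then show ?thesis using that by (auto simp: tri_upto_def tri_def)
  qed (use that in simp)
  moreover have "(j, 1) \<in> tri_upto d n t" if "(i, 2) \<in> tri_upto d n t" "j \<in> {2..n}" for i j
    using that key_less[of j n 1 2 i] by (auto simp: tri_upto_def tri_def)
  ultimately show ?thesis unfolding staircase_def by (auto simp: tri_upto_def tri_def)
qed

text \<open>Just before \<open>(i, c)\<close> is released, the points \<open>1, ..., c\<close> and
  \<open>i\<close> span at most \<open>c - 1\<close> axes.\<close>

lemma tri_upto_point:
  assumes "(i, c) \<in> tri d n" "y \<in> aff (tri_upto d n (key n (i, c)))" "b \<in> insert i {1..c}" "c \<le> k"
  shows "y (b, k) = 0"
proof -
  have "(b, k) \<notin> tri_upto d n (key n (i, c))"
    using assms key_less[of i n c k i] by (cases "k = c") (auto simp: tri_upto_def tri_def)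
  then show ?thesis using assms(2) by (auto simp: aff_def)
qed

text \<open>The Gram determinant of the points \<open>1, \<dots>, c, i\<close> (up to powers of minors) separates
  consecutive strata.\<close>

lemma stratum_step:
  assumes "(i, c) \<in> tri d n" "\<forall>e. (\<epsilon> e)\<^sup>2 = 1"
  defines "t \<equiv> key n (i, c)"
  shows "zclosure (pair_idx n) (stratum d n \<epsilon> (tri_upto d n t)) \<subset>
    zclosure (pair_idx n) (stratum d n \<epsilon> (tri_upto d n (Suc t)))"
proof -
  let ?I = "pair_idx n" and ?X = "stratum d n \<epsilon> (tri_upto d n t)"
    and ?X' = "stratum d n \<epsilon> (tri_upto d n (Suc t))"
  have ic: "1 \<le> c" "c \<le> d" "c < i" "i \<le> n" and d: "1 \<le> d" using assms(1) by (auto simp: tri_def)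
  \<comment> \<open>These are \<open>c - 1\<close> vectors, none for \<open>c = 1\<close>: exactly
    enough eliminations to annihilate a form of rank \<open>c - 1\<close>.\<close>
  define vs where "vs = [2..<c+1]"
  define Q where "Q = (\<lambda>x. fold schur (map unit_vec vs) (gram n (sq_map x)) (unit_vec i) (unit_vec i))"
  have Q: "Q \<in> poly_fun ?I" unfolding Q_def by (rule poly_fun_gram_sq)
  have "?X \<subseteq> ?X'"
    by (rule stratum_mono[OF staircase_tri_upto d assms(2)]) (auto simp: tri_upto_def)
  moreover have "\<forall>x\<in>?X. Q x = 0"
  proof
    fix x assume "x \<in> ?X"
    then obtain y where y: "y \<in> aff (tri_upto d n t)" "sq_map x = meas d n (curry y)"
      using stratum_sq_map[OF staircase_tri_upto d assms(2)] by blast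
    have y0: "y (b, k) = 0" if "b \<in> insert i {1..c}" "c \<le> k" for b k
      using tri_upto_point[OF assms(1) _ that] y(1) by (simp add: t_def)
    have sqlen_eq: "sqlen (meas d n (curry y)) a b = sqlen (meas (c - 1) n (curry y)) a b"
      if ab: "a \<in> insert i {1..c}" "b \<in> insert i {1..c}" for a b
    proof -
      have ab': "a \<in> {1..n}" "b \<in> {1..n}" using ab ic by auto
      have "(\<Sum>k=1..d. (curry y a k - curry y b k)\<^sup>2) = (\<Sum>k=1..c - 1. (curry y a k - curry y b k)\<^sup>2)"
        using ic y0[OF ab(1)] y0[OF ab(2)] by (intro sum.mono_neutral_right) auto
      then show ?thesis unfolding sqlen_meas[OF ab'] .
    qed
    define V where "V = unit_vec ` insert i {2..c}"
    have "Q x = fold schur (map unit_vec vs) (gram n (meas (c - 1) n (curry y))) (unit_vec i) (unit_vec i)"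
      unfolding Q_def y(2)
    proof (rule fold_schur_cong)
      show "gram n (meas d n (curry y)) v w = gram n (meas (c - 1) n (curry y)) v w"
        if vw: "v \<in> V" "w \<in> V" for v w
      proof -
        obtain a b where ab: "v = unit_vec a" "w = unit_vec b" "a \<in> insert i {2..c}" "b \<in> insert i {2..c}"
          using vw by (auto simp: V_def)
        then have mem: "a \<in> {1..n}" "b \<in> {1..n}" "a \<in> insert i {1..c}" "b \<in> insert i {1..c}"
          "1 \<in> insert i {1..c}" using ic by auto
        show ?thesis unfolding ab(1,2) gram_unit[OF mem(1,2)]
          using sqlen_eq[OF mem(5,3)] sqlen_eq[OF mem(5,4)] sqlen_eq[OF mem(3,4)] by simp
      qed
    qed (auto simp: V_def vs_def)
    also have "\<dots> = 0"
    proof (rule rank_le_fold_schur)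
      have "length (map unit_vec vs) = c - 1" unfolding vs_def length_map length_upt by simp
      then show "rank_le (length (map unit_vec vs)) (gram n (meas (c - 1) n (curry y)))"
        using rank_le_gram_meas by metis
    qed
    finally show "Q x = 0" .
  qed
  moreover have "\<exists>x\<in>?X'. Q x \<noteq> 0"
  proof -
    \<comment> \<open>The witness places points \<open>2, ..., c\<close> on the first
      \<open>c - 1\<close> axes and point \<open>i\<close> on the newly available axis
      \<open>c\<close>, so that \<open>Q\<close> equals 1.\<close>
    define A where "A = insert i {2..c}"
    define \<kappa> where "\<kappa> = (\<lambda>b. if b = i then c else b - 1)"
    have "frame A \<kappa> \<in> aff (tri_upto d n (Suc t))"
    proof -
      have "frame A \<kappa> (b, k) = 0" if "(b, k) \<notin> tri_upto d n (Suc t)" for b k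
      proof (rule ccontr)
        assume "frame A \<kappa> (b, k) \<noteq> 0"
        then have bk: "b \<in> A" "k = \<kappa> b" by (auto simp: frame_def split: if_splits)
        have "key n (b, k) < Suc t \<and> (b, k) \<in> tri d n"
        proof (cases "b = i")
          case True
          then show ?thesis using bk assms(1) by (simp add: \<kappa>_def t_def)
        next
          case False
          then have "key n (b, k) < t"
            unfolding t_def using bk ic by (intro key_less) (auto simp: \<kappa>_def A_def)
          then show ?thesis using False bk ic by (auto simp: \<kappa>_def A_def tri_def)
        qed
        then show False using that by (simp add: tri_upto_def)
      qed
      then show ?thesis by (auto simp: aff_def)
    qed
    then obtain x where x: "x \<in> ?X'" "sq_map x = meas d n (curry (frame A \<kappa>))"
      using stratum_fiber[OF staircase_tri_upto d assms(2)] by blast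
    have "gram n (meas d n (curry (frame A \<kappa>))) = diag_form A"
      using ic by (intro gram_frame) (auto simp: A_def \<kappa>_def inj_on_def)
    moreover have "fold schur (map unit_vec vs) (diag_form A) = diag_form {i}"
    proof -
      have "A - set vs = {i}" using ic by (auto simp: A_def vs_def)
      moreover have "fold schur (map unit_vec vs) (diag_form A) = diag_form (A - set vs)"
        by (rule fold_schur_diag_form) (auto simp: A_def vs_def)
      ultimately show ?thesis by simp
    qed
    ultimately have "Q x = 1" unfolding Q_def x(2) by (simp add: diag_form_def unit_vec_def)
    then show ?thesis by (intro bexI[OF _ x(1)]) simp
  qed
  ultimately show ?thesis
    using zclosure_mono[of ?X ?X' ?I] zclosure_superset[OF stratum_subset_aff, of d n \<epsilon> "tri_upto d n (Suc t)"] Q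
    by (fastforce simp: zclosure_def)
qed

text \<open>Most values of \<open>t\<close> are not keys and add nothing. The induction therefore
  indexes the chain by the number of released coordinates and keeps its top equal to the current
  closure.\<close>

lemma stratum_chain:
  assumes "1 \<le> d" "\<forall>e. (\<epsilon> e)\<^sup>2 = 1"
  shows "has_irred_chain (pair_idx n) (zclosure (pair_idx n) (stratum d n \<epsilon> (tri d n))) (card (tri d n))"
proof -
  let ?I = "pair_idx n"
  let ?C = "\<lambda>t. zclosure ?I (stratum d n \<epsilon> (tri_upto d n t))"
  let ?N = "\<lambda>t. card (tri_upto d n t)"
  have fin: "finite (tri_upto d n t)" for t using finite_tri by (simp add: tri_upto_def)
  have irr: "zariski_irreducible ?I (?C t)" for t
    by (rule prime_on_zclosure_irreducible[OF prime_on_stratum[OF staircase_tri_upto] stratum_subset_aff])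
  have chain: "\<exists>Z. (\<forall>j\<le>?N t. zariski_irreducible ?I (Z j) \<and> Z j \<subseteq> ?C t) \<and>
    (\<forall>j<?N t. Z j \<subset> Z (Suc j)) \<and> Z (?N t) = ?C t" for t
  proof (induction t)
    case 0
    have "?N 0 = 0" by (simp add: tri_upto_def)
    then show ?case using irr[of 0] by (intro exI[of _ "\<lambda>_. ?C 0"]) simp
  next
    case (Suc t)
    then obtain Z where Z: "\<And>j. j \<le> ?N t \<Longrightarrow> zariski_irreducible ?I (Z j) \<and> Z j \<subseteq> ?C t"
      "\<And>j. j < ?N t \<Longrightarrow> Z j \<subset> Z (Suc j)" "Z (?N t) = ?C t" by blast
    show ?case
    proof (cases "\<exists>z\<in>tri d n. key n z = t")
      case False
      then have "tri_upto d n (Suc t) = tri_upto d n t" by (auto simp: tri_upto_def less_Suc_eq)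
      then show ?thesis using Suc.IH by simp
    next
      case True
      then obtain i c where ic: "(i, c) \<in> tri d n" "t = key n (i, c)" by auto
      have "tri_upto d n (Suc t) = insert (i, c) (tri_upto d n t)"
        using ic key_inj[of n _ _ i c] by (auto simp: tri_upto_def less_Suc_eq tri_def)
      moreover have "(i, c) \<notin> tri_upto d n t" using ic by (simp add: tri_upto_def)
      ultimately have N: "?N (Suc t) = Suc (?N t)" using fin[of t] by simp
      have sub: "?C t \<subset> ?C (Suc t)" unfolding ic(2) by (rule stratum_step[OF ic(1) assms(2)])
      define Z' where "Z' = Z(Suc (?N t) := ?C (Suc t))"
      have "zariski_irreducible ?I (Z' j) \<and> Z' j \<subseteq> ?C (Suc t)" if "j \<le> Suc (?N t)" for j
        using that Z(1)[of j] sub irr[of "Suc t"] by (cases "j = Suc (?N t)") (auto simp: Z'_def)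
      moreover have "Z' j \<subset> Z' (Suc j)" if "j < Suc (?N t)" for j
        using that Z(2)[of j] Z(3) sub by (cases "j = ?N t") (auto simp: Z'_def)
      moreover have "Z' (Suc (?N t)) = ?C (Suc t)" by (simp add: Z'_def)
      ultimately show ?thesis unfolding N by blast
    qed
  qed
  define T where "T = Suc (Max (insert 0 (key n ` tri d n)))"
  have "key n z < T" if "z \<in> tri d n" for z
    unfolding T_def using that finite_tri by (intro le_imp_less_Suc Max_ge) auto
  then have "tri_upto d n T = tri d n" by (auto simp: tri_upto_def)
  then show ?thesis using chain[of T] unfolding has_irred_chain_def by auto
qed

text \<open>Axis \<open>c\<close> is open to the \<open>n - c\<close> points after point
  \<open>c\<close>. The induction adds the binomial to the sum to avoid truncated
  subtraction.\<close>

lemma card_tri: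
  assumes "d \<le> n"
  shows "card (tri d n) = d * n - ((d + 1) choose 2)"
proof -
  have "tri d n = (\<lambda>(c, i). (i, c)) ` (SIGMA c:{1..d}. {c<..n})" by (force simp: tri_def image_iff)
  then have "card (tri d n) = card (SIGMA c:{1..d}. {c<..n})"
    by (simp add: card_image inj_on_def)
  also have "\<dots> = (\<Sum>c=1..d. n - c)" by simp
  finally have card: "card (tri d n) = (\<Sum>c=1..d. n - c)" .
  have "(\<Sum>c=1..d. n - c) + ((d + 1) choose 2) = d * n"
    using assms
  proof (induction d)
    case (Suc d)
    have "(Suc d + 1 choose 2) = (d + 1 choose 2) + (d + 1)"
      by (simp add: numeral_2_eq_2)
    then show ?case using Suc by simp
  qed simp
  then show ?thesis using card by simp
qed

section \<open>The dimension bound\<close>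

text \<open>Counting: a chain of length k + 1 would give \<open>D^(k+1)\<close> independent polynomials of degree at
  most \<open>e D\<close> on \<open>L\<close>, but restriction to the k-parameter triangular configurations leaves room
  for only \<open>2^N (2 e D + 1)^k\<close>.\<close>

lemma no_long_chain:
  assumes "d < n"
  shows "\<not> has_irred_chain (pair_idx n) (L_set d n) (Suc (card (tri d n)))"
proof
  let ?I = "pair_idx n" and ?T = "tri d n"
  define k where "k = card ?T"
  assume "has_irred_chain ?I (L_set d n) (Suc (card ?T))"
  then obtain Z where Z: "\<forall>i\<le>Suc k. zariski_irreducible ?I (Z i)" "\<forall>i<Suc k. Z i \<subset> Z (Suc i)"
    "Z (Suc k) \<subseteq> L_set d n"
    unfolding has_irred_chain_def k_def by blast
  from chain_independent[OF Z(1,2)] obtain e where e: "\<forall>D. \<exists>h. (\<forall>a\<in>box (Suc k) D. poly_deg ?I (e * D) (h a)) \<and>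
    (\<forall>c. (\<forall>x\<in>Z (Suc k). (\<Sum>a\<in>box (Suc k) D. c a * h a x) = 0) \<longrightarrow> (\<forall>a\<in>box (Suc k) D. c a = 0))" ..
  \<comment> \<open>Since \<open>D \<ge> 1\<close>, \<open>2 * e * D + 1\<close> is at most
    \<open>(2 * e + 1) * D\<close>; the remaining constant factor is below \<open>D\<close>, so
    unknowns outnumber equations.\<close>
  define D where "D = 2 ^ card ?I * (2 * e + 1) ^ k + 1"
  let ?B = "box (Suc k) D"
  from e obtain h where h: "\<And>a. a \<in> ?B \<Longrightarrow> poly_deg ?I (e * D) (h a)"
    "\<And>c. (\<forall>x\<in>Z (Suc k). (\<Sum>a\<in>?B. c a * h a x) = 0) \<Longrightarrow> \<forall>a\<in>?B. c a = 0"
    by blast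
  have "\<forall>a\<in>?B. \<exists>F. (\<forall>S. poly_deg ?I (e * D) (F S)) \<and>
    (\<forall>x. h a x = (\<Sum>S\<in>Pow ?I. F S (\<lambda>v. if v \<in> ?I then (x v)\<^sup>2 else x v) * (\<Prod>e\<in>S. x e)))"
    using parity_decomposition[OF finite_pair_idx h(1)] by blast
  from bchoice[OF this] obtain F where FF: "\<forall>a\<in>?B. (\<forall>S. poly_deg ?I (e * D) (F a S)) \<and>
    (\<forall>x. h a x = (\<Sum>S\<in>Pow ?I. F a S (\<lambda>v. if v \<in> ?I then (x v)\<^sup>2 else x v) * (\<Prod>e\<in>S. x e)))" ..
  note F = conjunct1[OF bspec[OF FF], rule_format] conjunct2[OF bspec[OF FF], rule_format]
  define m where "m = 2 * (e * D)"
  define pt where "pt = (\<lambda>(\<gamma> :: nat \<times> nat \<Rightarrow> nat) v. if v \<in> ?T then of_nat (\<gamma> v) else (0 :: complex))"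
  \<comment> \<open>One equation for each parity class and each grid point of the triangular
    parameters. The grid has \<open>m + 1\<close> values per coordinate because a component of
    degree \<open>e * D\<close> composed with the quadratic \<open>meas\<close> has degree at most
    \<open>m\<close>.\<close>
  let ?A = "Pow ?I \<times> (\<Pi>\<^sub>E v\<in>?T. {..m})"
  have finA: "finite ?A" using finite_pair_idx finite_tri by (intro finite_cartesian_product finite_PiE) auto
  have finB: "finite ?B" using finite_lists_length_eq[of "{..<D}" "Suc k"] by simp
  have "card ?A = 2 ^ card ?I * (m + 1) ^ k"
    using finite_pair_idx finite_tri by (simp add: card_cartesian_product card_Pow card_PiE k_def)
  also have "\<dots> \<le> 2 ^ card ?I * ((2 * e + 1) * D) ^ k"
    by (intro mult_le_mono2 power_mono) (simp_all add: m_def D_def)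
  also have "\<dots> = (2 ^ card ?I * (2 * e + 1) ^ k) * D ^ k" by (simp only: power_mult_distrib mult.assoc)
  also have "\<dots> < D * D ^ k" by (intro mult_strict_right_mono) (simp_all add: D_def)
  also have "\<dots> = card ?B" using card_lists_length_eq[of "{..<D}" "Suc k"] by simp
  finally have less: "card ?A < card ?B" .
  from homogeneous_system[OF finA finB less, of "\<lambda>(S, \<gamma>) a. F a S (meas d n (curry (pt \<gamma>)))"] obtain c
    where C: "(\<exists>a\<in>?B. c a \<noteq> 0) \<and> (\<forall>z\<in>?A. (\<Sum>a\<in>?B.
      (case z of (S, \<gamma>) \<Rightarrow> \<lambda>a. F a S (meas d n (curry (pt \<gamma>)))) a * c a) = 0)" ..
  have c: "(\<Sum>a\<in>?B. F a S (meas d n (curry (pt \<gamma>))) * c a) = 0"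
    if "S \<in> Pow ?I" "\<gamma> \<in> (\<Pi>\<^sub>E v\<in>?T. {..m})" for S \<gamma>
    using bspec[OF conjunct2[OF C] SigmaI[OF that]] by simp
  define f where "f = (\<lambda>S x. \<Sum>a\<in>?B. c a * F a S x)"
  have fdeg: "poly_deg ?I (e * D) (f S)" for S
    unfolding f_def by (intro poly_deg_sum poly_deg_cmult F(1))
  have ftri: "f S (meas d n (curry y)) = 0" if S: "S \<in> Pow ?I" and y: "y \<in> aff ?T" for S y
  proof (rule poly_deg_grid_zero[OF finite_tri, where f = "\<lambda>y. f S (meas d n (curry y))" and z = "\<lambda>_. 0"])
    show "poly_deg UNIV m (\<lambda>y. f S (meas d n (curry y)))"
      unfolding m_def by (rule poly_deg_compose[OF fdeg poly_deg_meas])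
  next
    fix y' :: "nat \<times> nat \<Rightarrow> complex"
    assume y': "\<And>v. v \<in> ?T \<Longrightarrow> y' v \<in> of_nat ` {..m}" "\<And>v. v \<notin> ?T \<Longrightarrow> y' v = 0"
    have "\<forall>v\<in>?T. \<exists>j\<in>{..m}. y' v = of_nat j" using y'(1) by blast
    then obtain \<gamma> where \<gamma>: "\<And>v. v \<in> ?T \<Longrightarrow> \<gamma> v \<in> {..m}" "\<And>v. v \<in> ?T \<Longrightarrow> y' v = of_nat (\<gamma> v)" by metis
    have "y' = pt (restrict \<gamma> ?T)" using \<gamma>(2) y'(2) by (auto simp: pt_def)
    moreover have "restrict \<gamma> ?T \<in> (\<Pi>\<^sub>E v\<in>?T. {..m})" using \<gamma>(1) by auto
    ultimately show "f S (meas d n (curry y')) = 0"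
      using c[OF S] by (simp add: f_def mult.commute)
  qed (use y in \<open>auto simp: aff_def\<close>)
  have fM: "f S (meas d n p) = 0" if "S \<in> Pow ?I" for S p
    by (rule tri_dense[OF assms poly_deg_imp_poly_fun[OF fdeg]]) (rule ftri[OF that])
  have "(\<Sum>a\<in>?B. c a * h a x) = 0" if x: "x \<in> Z (Suc k)" for x
  proof -
    obtain p where p: "sq_map x = meas d n p" and xa: "x \<in> aff ?I"
      using x Z(3) by (auto simp: L_set_def M_set_def)
    have sq: "(\<lambda>v. if v \<in> ?I then (x v)\<^sup>2 else x v) = meas d n p"
      using xa unfolding p[symmetric] by (auto simp: sq_map_def aff_def)
    have "(\<Sum>a\<in>?B. c a * h a x) = (\<Sum>a\<in>?B. \<Sum>S\<in>Pow ?I. c a * F a S (meas d n p) * (\<Prod>e\<in>S. x e))"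
      by (intro sum.cong refl) (simp add: F(2) sq sum_distrib_left mult.assoc)
    also have "\<dots> = (\<Sum>S\<in>Pow ?I. \<Sum>a\<in>?B. c a * F a S (meas d n p) * (\<Prod>e\<in>S. x e))"
      by (rule sum.swap)
    also have "\<dots> = (\<Sum>S\<in>Pow ?I. f S (meas d n p) * (\<Prod>e\<in>S. x e))"
      by (simp add: f_def sum_distrib_right)
    also have "\<dots> = 0" using fM by (intro sum.neutral) simp
    finally show ?thesis .
  qed
  then have "\<forall>a\<in>?B. c a = 0" by (intro h(2)) blast
  then show False using conjunct1[OF C] by blast
qed

lemma has_irred_chain_mono: "has_irred_chain I V k \<Longrightarrow> V \<subseteq> W \<Longrightarrow> has_irred_chain I W k"
  unfolding has_irred_chain_def by (meson subset_trans)

text \<open>On a line each length is a signed difference, so finitely many sign patterns cover the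
  variety. An irreducible component lies in one of the closures and equals it by maximality.\<close>

lemma L_set_1_component:
  assumes V: "irred_component (pair_idx n) (L_set 1 n) V"
  shows "\<exists>\<epsilon>. (\<forall>e. (\<epsilon> e)\<^sup>2 = 1) \<and> V = zclosure (pair_idx n) (stratum 1 n \<epsilon> (tri 1 n))"
proof -
  let ?I = "pair_idx n" and ?T = "tri 1 n"
  define sgns where "sgns = (\<lambda>(S :: (nat \<times> nat) set) e. if e \<in> S then - 1 else (1 :: complex))"
  have sq1: "\<forall>e. (sgns S e)\<^sup>2 = 1" for S by (simp add: sgns_def)
  let ?C = "\<lambda>S. zclosure ?I (stratum 1 n (sgns S) ?T)"
  have T: "staircase 1 n ?T" by (auto simp: staircase_def tri_def)
  have quad: "quad n ?T = {}" by (auto simp: quad_def tri_def)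
  have irr: "zariski_irreducible ?I V" and VL: "V \<subseteq> L_set 1 n"
    and maxi: "\<And>W. zariski_irreducible ?I W \<Longrightarrow> V \<subseteq> W \<Longrightarrow> W \<subseteq> L_set 1 n \<Longrightarrow> W = V"
    using V by (auto simp: irred_component_def)
  have "L_set 1 n \<subseteq> (\<Union>S\<in>Pow ?I. ?C S)"
  proof
    fix x assume x: "x \<in> L_set 1 n"
    then obtain p where p: "sq_map x = meas 1 n p" by (auto simp: L_set_def M_set_def)
    \<comment> \<open>Translation puts point 1 at the origin, where \<open>tri\<close> requires
      it.\<close>
    define y where "y = (\<lambda>(i, k). if (i, k) \<in> ?T then p i k - p 1 k else 0)"
    define S where "S = {e \<in> ?I. x e \<noteq> y (fst e, 1) - y (snd e, 1)}"
    have "x e = lengths 1 n (sgns S) ?T y e" if "e \<in> ?I" for e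
    proof -
      obtain a b where e: "e = (a, b)" by force
      have "y (a, 1) - y (b, 1) = p a 1 - p b 1"
        using that by (auto simp: e y_def tri_def pair_idx_def)
      moreover have "(x e)\<^sup>2 = (p a 1 - p b 1)\<^sup>2"
        using fun_cong[OF p, of e] that by (simp add: sq_map_def meas_def e)
      ultimately have "(x e)\<^sup>2 = (y (a, 1) - y (b, 1))\<^sup>2" by simp
      then have "x e = y (a, 1) - y (b, 1) \<or> x e = - (y (a, 1) - y (b, 1))"
        by (simp only: power2_eq_iff)
      then show ?thesis using that unfolding lengths_def quad by (auto simp: S_def sgns_def e)
    qed
    moreover have "y \<in> aff ?T" by (auto simp: y_def aff_def)
    moreover have "x \<in> aff ?I" using x by (simp add: L_set_def)
    ultimately have "x \<in> stratum 1 n (sgns S) ?T"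
      unfolding stratum_def cover_def quad by auto
    then have "x \<in> ?C S" using zclosure_superset[OF stratum_subset_aff] by blast
    moreover have "S \<in> Pow ?I" by (auto simp: S_def)
    ultimately show "x \<in> (\<Union>S\<in>Pow ?I. ?C S)" by blast
  qed
  then have "\<exists>S\<in>Pow ?I. V \<subseteq> ?C S"
    using VL finite_pair_idx by (intro irreducible_covered[OF irr]) (auto intro: zariski_closed_zclosure)
  then obtain S where S: "V \<subseteq> ?C S" by blast
  have "?C S \<subseteq> L_set 1 n"
    using stratum_subset_L_set[OF T _ sq1] by (intro zclosure_minimal[OF zariski_closed_L_set]) simp
  then have "?C S = V"
    using maxi[OF prime_on_zclosure_irreducible[OF prime_on_stratum[OF T] stratum_subset_aff] S] by simp
  then show ?thesis using sq1 by blast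
qed

text \<open>The upper bound is inherited from the whole variety. The lower bound needs a chain
  inside each component: for \<open>d \<ge> 2\<close> the variety is the only one, for
  \<open>d = 1\<close> each is the closure of a stratum.\<close>

lemma pure_dim_L_set:
  assumes "1 \<le> d" "d < n"
  shows "pure_dim (pair_idx n) (L_set d n) (card (tri d n))"
  unfolding pure_dim_def
proof (intro conjI allI impI)
  show "zariski_closed (pair_idx n) (L_set d n)" by (rule zariski_closed_L_set)
next
  fix V assume V: "irred_component (pair_idx n) (L_set d n) V"
  then have VL: "V \<subseteq> L_set d n" by (simp add: irred_component_def)
  have T: "staircase d n (tri d n)"
    using assms(2) by (auto simp: staircase_def tri_def)
  have "has_irred_chain (pair_idx n) V (card (tri d n))"
  proof (cases "d = 1")
    case True
    then obtain \<epsilon> where "\<forall>e. (\<epsilon> e)\<^sup>2 = 1" "V = zclosure (pair_idx n) (stratum 1 n \<epsilon> (tri 1 n))"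
      using L_set_1_component V by blast
    then show ?thesis using stratum_chain[of 1 \<epsilon> n] True by simp
  next
    case False
    then have "zariski_irreducible (pair_idx n) (L_set d n)"
      using assms(1) by (intro L_set_irreducible) simp
    then have "V = L_set d n" using V VL unfolding irred_component_def by blast
    moreover have "zclosure (pair_idx n) (stratum d n (\<lambda>_. 1) (tri d n)) \<subseteq> L_set d n"
      using stratum_subset_L_set[OF T assms(1), of "\<lambda>_. 1"]
      by (intro zclosure_minimal[OF zariski_closed_L_set]) simp
    ultimately show ?thesis
      using has_irred_chain_mono[OF stratum_chain[OF assms(1), of "\<lambda>_. 1"]] by simp
  qed
  moreover have "\<not> has_irred_chain (pair_idx n) V (Suc (card (tri d n)))"
    using no_long_chain[OF assms(2)] has_irred_chain_mono VL by blast
  ultimately show "alg_dim_eq (pair_idx n) V (card (tri d n))" by (simp add: alg_dim_eq_def)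
qed

theorem theorem2p11:
  fixes d n :: nat
  assumes "1 \<le> d" and "d + 2 \<le> n"
  shows "zariski_closed (pair_idx n) (L_set d n)
       \<and> pure_dim (pair_idx n) (L_set d n) (d * n - ((d + 1) choose 2))
       \<and> (2 \<le> d \<longrightarrow> zariski_irreducible (pair_idx n) (L_set d n))"
  using zariski_closed_L_set pure_dim_L_set[of d n] card_tri[of d n] L_set_irreducible assms by simp

end
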